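(* The median eigenvalues $\lambda_H$ and $\lambda_L$ of every subcubic graph are contained in the interval $[-\sqrt{2},\sqrt{2}\,]$. Consequently, $R(3) = \sqrt{2}$.
   Context: A graph $G$ is subcubic if its maximum degree $\Delta(G)$ is at most $3$. For a graph $G$ of order $n$, let $\lambda_1\ge \lambda_2\ge \cdots \ge\lambda_n$ be the eigenvalues of its adjacency matrix, and let $H=\lfloor \tfrac{n+1}{2}\rfloor$ and $L=\lceil \tfrac{n+1}{2}\rceil$. The HL-index of $G$ is $R(G) = \max \{|\lambda_H|,|\lambda_L|\}$. For a positive real $d$, $R(d) = \sup \{R(G)\mid \Delta(G)\le d\}$, so $R(3)$ is the supremum of $R(G)$ over all subcubic graphs $G$. *)

theory Defs
  imports
    "Graph_Theory.Pair_Digraph"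
    "Jordan_Normal_Form.Char_Poly"
    "HOL-Computational_Algebra.Polynomial"
    Complex_Main
begin

text \<open>
  A finite simple graph is a \<open>pair_graph\<close>: a finite vertex set together with a finite, symmetric,
  irreflexive set of arcs, so that an undirected edge \<open>uv\<close> is represented by the two arcs
  \<open>(u, v)\<close> and \<open>(v, u)\<close>. The out-degree of a vertex is therefore its usual degree.
\<close>

definition order_of :: "'a pair_pre_digraph \<Rightarrow> nat" where
  "order_of G = card (pverts G)"

definition max_degree :: "'a pair_pre_digraph \<Rightarrow> nat" where
  "max_degree G = Max (out_degree (with_proj G) ` pverts G)"

definition subcubic :: "'a pair_pre_digraph \<Rightarrow> bool" where
  "subcubic G \<longleftrightarrow> max_degree G \<le> 3"

text \<open>
  Rows and columns of the adjacency matrix are indexed by an arbitrary enumeration of the vertices;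
  another choice conjugates the matrix by a permutation matrix and leaves the spectrum unchanged.
\<close>

definition vertex_enum :: "'a pair_pre_digraph \<Rightarrow> 'a list" where
  "vertex_enum G = (SOME vs. distinct vs \<and> set vs = pverts G)"

lemma vertex_enum:
  assumes "finite (pverts G)"
  shows "distinct (vertex_enum G)" "set (vertex_enum G) = pverts G"
    "length (vertex_enum G) = order_of G"
proof -
  have "\<exists>vs. distinct vs \<and> set vs = pverts G"
    using finite_distinct_list[OF assms] by blast
  then have *: "distinct (vertex_enum G) \<and> set (vertex_enum G) = pverts G"
    unfolding vertex_enum_def by (rule someI_ex)
  then show "distinct (vertex_enum G)" "set (vertex_enum G) = pverts G" by auto
  with distinct_card show "length (vertex_enum G) = order_of G"
    unfolding order_of_def by fastforce
qed

definition adjacency_mat :: "'a pair_pre_digraph \<Rightarrow> real mat" where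
  "adjacency_mat G = mat (order_of G) (order_of G)
     (\<lambda>(i, j). if (vertex_enum G ! i, vertex_enum G ! j) \<in> parcs G then 1 else 0)"

text \<open>
  The eigenvalues with multiplicity, in non-increasing order. As the adjacency matrix is real
  symmetric, its characteristic polynomial splits over the reals, and the list has length
  \<open>order_of G\<close>.
\<close>

definition eigenvalue_list :: "'a pair_pre_digraph \<Rightarrow> real list" where
  "eigenvalue_list G = rev (sorted_list_of_multiset (proots (char_poly (adjacency_mat G))))"

text \<open>The eigenvalues are numbered from 1, whereas list positions start at 0.\<close>

definition eigval :: "'a pair_pre_digraph \<Rightarrow> nat \<Rightarrow> real" where
  "eigval G i = eigenvalue_list G ! (i - 1)"

definition H_index :: "'a pair_pre_digraph \<Rightarrow> nat" where
  "H_index G = nat \<lfloor>(real (order_of G) + 1) / 2\<rfloor>"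

definition L_index :: "'a pair_pre_digraph \<Rightarrow> nat" where
  "L_index G = nat \<lceil>(real (order_of G) + 1) / 2\<rceil>"

definition HL_index :: "'a pair_pre_digraph \<Rightarrow> real" where
  "HL_index G = max \<bar>eigval G (H_index G)\<bar> \<bar>eigval G (L_index G)\<bar>"

text \<open>
  Every finite graph is isomorphic to one whose vertices are natural numbers, so restricting the
  vertex type does not change the supremum. The empty graph has no median eigenvalues and is excluded.
\<close>

definition HL_sup :: "real \<Rightarrow> real" where
  "HL_sup d = Sup {HL_index G | G :: nat pair_pre_digraph.
     pair_graph G \<and> pverts G \<noteq> {} \<and> real (max_degree G) \<le> d}"

end

theory Submission
  imports Defs
begin

text \<open>
  Take a cut with the fewest monochromatic edges. In a subcubic graph every vertex then has at most
  one neighbour in its own class, so the quadratic form of the adjacency matrix is at most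
  \<open>\<bar>x\<bar>\<^sup>2\<close> in absolute value on the vectors supported on one class. If the cut is unbalanced,
  Courant--Fischer applied to the larger class bounds both median eigenvalues by \<open>1\<close>.

  If the classes \<open>A\<close> and \<open>B\<close> have equal size, one dimension is missing, and a vector \<open>y\<close> on \<open>A\<close> has to be
  added to the space of vectors on \<open>B\<close>. By a Schur complement this is possible as soon as
  \<open>w\<^sup>T (sqrt 2 - s M)\<inverse> w \<le> sqrt 2 \<bar>y\<bar>\<^sup>2 - s q(y)\<close>, where \<open>q\<close> is the quadratic form, \<open>w\<close> is the image of \<open>y\<close> in \<open>B\<close>, \<open>M\<close>
  the matching inside \<open>B\<close>, and \<open>s = 1\<close> or \<open>s = - 1\<close> for the upper or lower bound. Vectors \<open>y\<close> with one
  or two nonzero entries suffice: two vertices with a common neighbour if no edge is monochromatic,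
  and the two ends of a monochromatic edge otherwise. For \<open>s = - 1\<close> the latter can fail only if every
  monochromatic edge lies in a triangle of a special shape; exchanging the colours of two vertices
  gives another optimal cut, and comparing both produces a vertex of degree four.

  The Heawood graph attains the bound, because its biadjacency matrix satisfies
  \<open>N N\<^sup>T = 2 I + J\<close> and hence all its eigenvalues are at least \<open>sqrt 2\<close> in absolute value.
\<close>

section \<open>Real symmetric matrices\<close>

lemma scalar_prod_self_pos:
  fixes v :: "real vec"
  assumes "v \<in> carrier_vec n" "v \<noteq> 0\<^sub>v n"
  shows "v \<bullet> v > 0"
proof -
  obtain i where i: "i < n" "v $ i \<noteq> 0"
    using assms by (metis carrier_vecD eq_vecI index_zero_vec)
  have "v \<bullet> v = (\<Sum>j<n. (v $ j)\<^sup>2)"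
    using assms(1) by (simp add: scalar_prod_def power2_eq_square atLeast0LessThan)
  also have "\<dots> > 0"
    by (rule sum_pos2[of _ i]) (use i in auto)
  finally show ?thesis .
qed

text \<open>This is the Householder reflection along \<open>w = v - e_0\<close>: both vectors have
  length one, so it exchanges \<open>e_0\<close> and \<open>v\<close>. For \<open>v = e_0\<close>
  the direction degenerates and the identity serves. It supplies the orthogonal matrix for the
  deflation step below.\<close>

lemma exists_reflection:
  fixes v :: "real vec"
  assumes v: "v \<in> carrier_vec (Suc n)" and v1: "v \<bullet> v = 1"
  shows "\<exists>H \<in> carrier_mat (Suc n) (Suc n). H * H = 1\<^sub>m (Suc n) \<and> transpose_mat H = H \<and> col H 0 = v"
proof (cases "v = unit_vec (Suc n) 0")
  case True
  then show ?thesis by (intro bexI[of _ "1\<^sub>m (Suc n)"]) auto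
next
  case False
  define N where "N = Suc n"
  define w where "w = v - unit_vec N 0"
  define c where "c = w \<bullet> w"
  have w: "w \<in> carrier_vec N" using v by (simp add: w_def N_def)
  have "w \<noteq> 0\<^sub>v N"
  proof
    assume w0: "w = 0\<^sub>v N"
    have "v = unit_vec N 0"
    proof (rule eq_vecI)
      fix i assume "i < dim_vec (unit_vec N 0)"
      then show "v $ i = unit_vec N 0 $ i"
        using arg_cong[OF w0, of "\<lambda>x. x $ i"] v by (auto simp: w_def N_def)
    qed (use v in \<open>auto simp: N_def\<close>)
    with False show False by (simp add: N_def)
  qed
  then have c: "c > 0" unfolding c_def using scalar_prod_self_pos[OF w] by simp
  have wi: "w $ i = v $ i - (if i = 0 then 1 else 0)" if "i < N" for i
    using that v by (auto simp: w_def N_def)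
  have cw: "c = (\<Sum>k<N. w $ k * w $ k)"
    using w by (simp add: c_def scalar_prod_def atLeast0LessThan)
  have v1': "(\<Sum>k<N. v $ k * v $ k) = 1"
    using v v1 by (simp add: scalar_prod_def atLeast0LessThan N_def)
  have "c = (\<Sum>k<N. v $ k * v $ k - (if k = 0 then 2 * v $ 0 - 1 else 0))"
    unfolding cw by (rule sum.cong) (auto simp: wi algebra_simps)
  also have "\<dots> = 1 - (2 * v $ 0 - 1)"
    unfolding sum_subtractf v1' by (simp add: N_def)
  finally have c2: "c = - 2 * (v $ 0 - 1)" by simp
  define H where "H = mat N N (\<lambda>(i, j). (if i = j then 1 else 0) - 2 * w $ i * w $ j / c)"
  have H: "H \<in> carrier_mat N N" by (simp add: H_def)
  have "H * H = 1\<^sub>m N"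
  proof (rule eq_matI)
    fix i j assume "i < dim_row (1\<^sub>m N :: real mat)" "j < dim_col (1\<^sub>m N :: real mat)"
    then have ij: "i < N" "j < N" by auto
    have "(H * H) $$ (i, j) = (\<Sum>k<N. H $$ (i, k) * H $$ (k, j))"
      using ij H by (simp add: scalar_prod_def atLeast0LessThan)
    also have "\<dots> = (\<Sum>k<N. (if k = i then (if i = j then 1 else 0) - 2 * w $ i * w $ j / c else 0)
        - (if k = j then 2 * w $ i * w $ j / c else 0) + (4 * w $ i * w $ j / c\<^sup>2) * (w $ k * w $ k))"
      using ij by (intro sum.cong) (auto simp: H_def algebra_simps power2_eq_square)
    also have "\<dots> = (if i = j then 1 else 0) - 4 * w $ i * w $ j / c + (4 * w $ i * w $ j / c\<^sup>2) * c"
      using ij unfolding sum.distrib sum_subtractf sum_distrib_left[symmetric] cw[symmetric] by simp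
    also have "\<dots> = (if i = j then 1 else 0)"
      using c by (simp add: power2_eq_square)
    finally show "(H * H) $$ (i, j) = 1\<^sub>m N $$ (i, j)" using ij by simp
  qed (use H in auto)
  moreover have "transpose_mat H = H"
    by (rule eq_matI) (auto simp: H_def)
  moreover have "col H 0 = v"
  proof (rule eq_vecI)
    fix i assume "i < dim_vec v"
    then have i: "i < N" using v by (simp add: N_def)
    \<comment> \<open>The column is \<open>e_0 - (2 * w $ 0 / c) w\<close>, and this relation makes
      the factor \<open>-1\<close>, leaving \<open>e_0 + w = v\<close>.\<close>
    have "2 * w $ 0 = - c" using wi[of 0] c2 by (simp add: N_def)
    then have "2 * w $ i * w $ 0 / c = w $ i * (- c) / c" by (metis mult.assoc mult.commute)
    also have "\<dots> = - w $ i" using c by simp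
    finally have "2 * w $ i * w $ 0 / c = - w $ i" .
    then show "col H 0 $ i = v $ i" using i by (simp add: H_def N_def wi)
  qed (use v H in \<open>auto simp: N_def\<close>)
  ultimately show ?thesis using H unfolding N_def by blast
qed

lemma symmetric_scalar_prod:
  fixes A :: "'a :: comm_ring_1 mat"
  assumes "A \<in> carrier_mat n n" "transpose_mat A = A" "x \<in> carrier_vec n" "y \<in> carrier_vec n"
  shows "x \<bullet> (A *\<^sub>v y) = (A *\<^sub>v x) \<bullet> y"
  using assms transpose_vec_mult_scalar[of A n n y x] by simp

text \<open>A complex eigenvector is split as \<open>x + i y\<close>. Comparing \<open>y\<close>
  with \<open>A x\<close> and \<open>A y\<close> with \<open>x\<close> by symmetry yields
  \<open>Im c * (x . x + y . y) = 0\<close>, so the root is real, and whichever of \<open>x\<close>,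
  \<open>y\<close> is nonzero is a real eigenvector.\<close>

lemma symmetric_real_eigenvector:
  fixes A :: "real mat"
  assumes A: "A \<in> carrier_mat n n" and sym: "transpose_mat A = A" and n: "n > 0"
  shows "\<exists>v e. v \<in> carrier_vec n \<and> v \<bullet> v = 1 \<and> A *\<^sub>v v = e \<cdot>\<^sub>v v"
proof -
  let ?C = "map_mat complex_of_real A"
  have C: "?C \<in> carrier_mat n n" using A by simp
  have "degree (char_poly ?C) = n" using degree_monic_char_poly[OF C] by simp
  then have "\<not> constant (poly (char_poly ?C))"
    using n by (simp add: constant_degree)
  then obtain c where c: "poly (char_poly ?C) c = 0"
    using fundamental_theorem_of_algebra by blast
  then obtain z where z: "z \<in> carrier_vec n" "z \<noteq> 0\<^sub>v n" and Cz: "?C *\<^sub>v z = c \<cdot>\<^sub>v z"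
    using eigenvalue_root_char_poly[OF C] C unfolding eigenvalue_def eigenvector_def by auto
  define x where "x = vec n (\<lambda>i. Re (z $ i))"
  define y where "y = vec n (\<lambda>i. Im (z $ i))"
  have xy: "x \<in> carrier_vec n" "y \<in> carrier_vec n" by (auto simp: x_def y_def)
  have Azi: "(\<Sum>k<n. of_real (A $$ (i, k)) * z $ k) = c * z $ i" if "i < n" for i
    using arg_cong[OF Cz, of "\<lambda>u. u $ i"] that A z by (simp add: scalar_prod_def atLeast0LessThan)
  have Ax: "A *\<^sub>v x = Re c \<cdot>\<^sub>v x - Im c \<cdot>\<^sub>v y"
  proof (rule eq_vecI)
    fix i assume "i < dim_vec (Re c \<cdot>\<^sub>v x - Im c \<cdot>\<^sub>v y)"
    then have i: "i < n" using xy by simp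
    show "(A *\<^sub>v x) $ i = (Re c \<cdot>\<^sub>v x - Im c \<cdot>\<^sub>v y) $ i"
      using arg_cong[OF Azi[OF i], of Re] i A xy
      by (simp add: scalar_prod_def atLeast0LessThan x_def y_def)
  qed (use A xy in auto)
  have Ay: "A *\<^sub>v y = Im c \<cdot>\<^sub>v x + Re c \<cdot>\<^sub>v y"
  proof (rule eq_vecI)
    fix i assume "i < dim_vec (Im c \<cdot>\<^sub>v x + Re c \<cdot>\<^sub>v y)"
    then have i: "i < n" using xy by simp
    show "(A *\<^sub>v y) $ i = (Im c \<cdot>\<^sub>v x + Re c \<cdot>\<^sub>v y) $ i"
      using arg_cong[OF Azi[OF i], of Im] i A xy
      by (simp add: scalar_prod_def atLeast0LessThan x_def y_def)
  qed (use A xy in auto)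
  have nz: "x \<noteq> 0\<^sub>v n \<or> y \<noteq> 0\<^sub>v n"
  proof (rule ccontr)
    assume "\<not> ?thesis"
    then have xy0: "x = 0\<^sub>v n" "y = 0\<^sub>v n" by auto
    have "z = 0\<^sub>v n"
    proof (rule eq_vecI)
      fix i assume "i < dim_vec (0\<^sub>v n :: complex vec)"
      then show "z $ i = 0\<^sub>v n $ i"
        using arg_cong[OF xy0(1), of "\<lambda>u. u $ i"] arg_cong[OF xy0(2), of "\<lambda>u. u $ i"]
        by (simp add: x_def y_def complex_eq_iff)
    qed (use z in auto)
    with z show False by simp
  qed
  have pos: "x \<bullet> x + y \<bullet> y > 0"
    using nz scalar_prod_self_pos[OF xy(1)] scalar_prod_self_pos[OF xy(2)]
    by (cases "x = 0\<^sub>v n"; cases "y = 0\<^sub>v n") auto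
  have "y \<bullet> (A *\<^sub>v x) = (A *\<^sub>v y) \<bullet> x"
    using symmetric_scalar_prod[OF A sym xy(2,1)] .
  then have "Re c * (y \<bullet> x) - Im c * (y \<bullet> y) = Im c * (x \<bullet> x) + Re c * (y \<bullet> x)"
    unfolding Ax Ay using xy
    by (simp add: scalar_prod_minus_distrib[of _ n] add_scalar_prod_distrib[of _ n])
  then have "Im c * (x \<bullet> x + y \<bullet> y) = 0" by (simp add: algebra_simps)
  with pos have c0: "Im c = 0" by simp
  have *: "A *\<^sub>v x = Re c \<cdot>\<^sub>v x" "A *\<^sub>v y = Re c \<cdot>\<^sub>v y"
    using Ax Ay xy by (auto simp: c0)
  obtain u where u: "u \<in> carrier_vec n" "u \<noteq> 0\<^sub>v n" "A *\<^sub>v u = Re c \<cdot>\<^sub>v u"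
    using nz * xy by blast
  define d where "d = 1 / sqrt (u \<bullet> u)"
  have uu: "u \<bullet> u > 0" using scalar_prod_self_pos u by blast
  have "(d \<cdot>\<^sub>v u) \<bullet> (d \<cdot>\<^sub>v u) = d * d * (u \<bullet> u)" using u by simp
  also have "\<dots> = 1" using uu by (simp add: d_def)
  finally have "(d \<cdot>\<^sub>v u) \<bullet> (d \<cdot>\<^sub>v u) = 1" .
  moreover have "A *\<^sub>v (d \<cdot>\<^sub>v u) = Re c \<cdot>\<^sub>v (d \<cdot>\<^sub>v u)"
    using u A by (simp add: mult_mat_vec smult_smult_assoc mult.commute)
  ultimately show ?thesis using u(1) by (intro exI[of _ "d \<cdot>\<^sub>v u"] exI[of _ "Re c"]) auto
qed

text \<open>Deflation: conjugating by a reflection whose first column is an eigenvector clears the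
  first column off the diagonal, by symmetry also the first row, and the induction hypothesis
  handles the remaining block. Having the transpose as inverse witness encodes that \<open>Q\<close>
  is orthogonal.\<close>

theorem symmetric_real_diagonalisation:
  fixes A :: "real mat"
  assumes "A \<in> carrier_mat n n" "transpose_mat A = A"
  shows "\<exists>Q d. similar_mat_wit A (mat_diag n d) Q (transpose_mat Q)"
  using assms
proof (induction n arbitrary: A)
  case 0
  then show ?case
    by (intro exI[of _ "1\<^sub>m 0"] exI) (auto intro!: similar_mat_witI[of _ _ 0])
next
  case (Suc n)
  note A = Suc.prems(1)
  obtain v e where v: "v \<in> carrier_vec (Suc n)" "v \<bullet> v = 1" and Av: "A *\<^sub>v v = e \<cdot>\<^sub>v v"
    using symmetric_real_eigenvector[OF Suc.prems] by blast
  obtain H where H: "H \<in> carrier_mat (Suc n) (Suc n)" and HH: "H * H = 1\<^sub>m (Suc n)"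
    and HT: "transpose_mat H = H" and Hv: "col H 0 = v"
    using exists_reflection[OF v] by blast
  define B where "B = H * A * H"
  have B: "B \<in> carrier_mat (Suc n) (Suc n)" using H A by (simp add: B_def)
  have HA: "H * A \<in> carrier_mat (Suc n) (Suc n)" using H A by simp
  have "transpose_mat B = transpose_mat H * (transpose_mat A * transpose_mat H)"
    unfolding B_def transpose_mult[OF HA H] transpose_mult[OF H A] ..
  also have "\<dots> = B"
    unfolding B_def HT Suc.prems(2) using H A by (simp add: assoc_mult_mat[of _ _ "Suc n" _ "Suc n"])
  finally have BT: "transpose_mat B = B" .
  have "col B 0 = (H * A) *\<^sub>v v"
    unfolding B_def using col_mult2[OF HA H, of 0] Hv by simp
  also have "\<dots> = e \<cdot>\<^sub>v (H *\<^sub>v v)"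
    using H A v Av by (simp add: assoc_mult_mat_vec[of _ "Suc n" "Suc n" _ "Suc n"] mult_mat_vec)
  also have "H *\<^sub>v v = col (H * H) 0"
    using H Hv by (metis col_mult2 zero_less_Suc)
  finally have colB: "col B 0 = e \<cdot>\<^sub>v unit_vec (Suc n) 0" by (simp add: HH)
  have B0: "B $$ (i, 0) = (if i = 0 then e else 0)" if "i < Suc n" for i
    using arg_cong[OF colB, of "\<lambda>u. u $ i"] that B by (auto split: if_splits)
  have Bsym: "B $$ (i, j) = B $$ (j, i)" if "i < Suc n" "j < Suc n" for i j
    using arg_cong[OF BT, of "\<lambda>M. M $$ (j, i)"] that B by simp
  define A' where "A' = mat n n (\<lambda>(i, j). B $$ (Suc i, Suc j))"
  have A': "A' \<in> carrier_mat n n" by (simp add: A'_def)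
  have "transpose_mat A' = A'"
    by (rule eq_matI) (auto simp: A'_def Bsym)
  from Suc.IH[OF A' this] obtain Q d where
    Q: "similar_mat_wit A' (mat_diag n d) Q (transpose_mat Q)" by blast
  have Qc: "Q \<in> carrier_mat n n" using similar_mat_witD2[OF A' Q] by auto
  let ?E = "mat 1 1 (\<lambda>_. e)"
  let ?F = "four_block_mat (1\<^sub>m 1) (0\<^sub>m 1 n) (0\<^sub>m n 1) Q"
  let ?G = "four_block_mat (1\<^sub>m 1) (0\<^sub>m 1 n) (0\<^sub>m n 1) (transpose_mat Q)"
  have BE: "B = four_block_mat ?E (0\<^sub>m 1 n) (0\<^sub>m n 1) A'"
  proof (rule eq_matI)
    fix i j assume "i < dim_row (four_block_mat ?E (0\<^sub>m 1 n) (0\<^sub>m n 1) A')"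
      "j < dim_col (four_block_mat ?E (0\<^sub>m 1 n) (0\<^sub>m n 1) A')"
    then have "i < Suc n" "j < Suc n" using A' by auto
    then show "B $$ (i, j) = four_block_mat ?E (0\<^sub>m 1 n) (0\<^sub>m n 1) A' $$ (i, j)"
      using A' B0[of i] B0[of j] Bsym[of 0 j]
      by (cases i; cases j) (auto simp: A'_def)
  qed (use B A' in auto)
  let ?d = "\<lambda>i. if i = 0 then e else d (i - 1)"
  have D: "mat_diag (Suc n) ?d = four_block_mat ?E (0\<^sub>m 1 n) (0\<^sub>m n 1) (mat_diag n d)"
    by (rule eq_matI) (auto simp: mat_diag_def)
  have E: "?E \<in> carrier_mat 1 1" by simp
  have 1: "similar_mat_wit ?E ?E (1\<^sub>m 1) (1\<^sub>m 1)" by (rule similar_mat_wit_refl[OF E])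
  have "similar_mat_wit B (mat_diag (Suc n) ?d) ?F ?G"
    unfolding D BE
    by (rule similar_mat_wit_four_block[OF 1 Q _ _ E A']) (use Qc in auto)
  moreover have "similar_mat_wit A B H H"
  proof (rule similar_mat_witI[OF HH HH _ A B H H])
    have "H * B * H = H * (H * A * (H * H))"
      unfolding B_def using H A
      by (simp add: assoc_mult_mat[of _ "Suc n" "Suc n" _ "Suc n" _ "Suc n"])
    also have "\<dots> = H * (H * A)" unfolding HH right_mult_one_mat[OF HA] ..
    also have "\<dots> = (H * H) * A" by (rule assoc_mult_mat[OF H H A, symmetric])
    finally show "A = H * B * H" using A by (simp add: HH)
  qed
  ultimately have "similar_mat_wit A (mat_diag (Suc n) ?d) (H * ?F) (?G * H)"
    by (rule similar_mat_wit_trans[rotated])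
  moreover have "?G * H = transpose_mat (H * ?F)"
  proof -
    have F: "?F \<in> carrier_mat (Suc n) (Suc n)" using Qc by (metis four_block_carrier_mat one_carrier_mat plus_1_eq_Suc)
    have "transpose_mat (H * ?F) = transpose_mat ?F * H"
      using transpose_mult[OF H F] HT by simp
    also have "transpose_mat ?F = ?G"
      using Qc by (simp add: transpose_four_block_mat[of _ 1 1 _ n _ n])
    finally show ?thesis by simp
  qed
  ultimately show ?case by metis
qed

section \<open>Counting eigenvalues by linear equations\<close>

lemma exists_common_zero:
  fixes gs :: "'a :: field vec list"
  assumes gs: "set gs \<subseteq> carrier_vec n" and len: "length gs < n"
  shows "\<exists>c \<in> carrier_vec n. c \<noteq> 0\<^sub>v n \<and> (\<forall>g \<in> set gs. g \<bullet> c = 0)"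
proof -
  define M where "M = mat n n (\<lambda>(i, j). if i < length gs then gs ! i $ j else 0)"
  have M: "M \<in> carrier_mat n n" by (simp add: M_def)
  \<comment> \<open>\<open>M\<close> was padded with zero rows to be square. As
    \<open>length gs < n\<close>, its last row is zero, so the last unit vector is annihilated by
    the transpose and the determinant vanishes.\<close>
  have "transpose_mat M *\<^sub>v unit_vec n (n - 1) = 0\<^sub>v n"
  proof (rule eq_vecI)
    fix i assume "i < dim_vec (0\<^sub>v n :: 'a vec)"
    then show "(transpose_mat M *\<^sub>v unit_vec n (n - 1)) $ i = 0\<^sub>v n $ i"
      using len by (simp add: M_def)
  qed (use M in simp)
  moreover have "unit_vec n (n - 1) \<noteq> (0\<^sub>v n :: 'a vec)"
    using len arg_cong[of "unit_vec n (n - 1)" "0\<^sub>v n :: 'a vec" "\<lambda>u. u $ (n - 1)"] by auto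
  ultimately have "det (transpose_mat M) = 0"
    using det_0_iff_vec_prod_zero_field[of "transpose_mat M" n] M
    by (metis transpose_carrier_mat unit_vec_carrier)
  then have "det M = 0" using det_transpose[OF M] by simp
  then obtain c where c: "c \<in> carrier_vec n" "c \<noteq> 0\<^sub>v n" "M *\<^sub>v c = 0\<^sub>v n"
    using det_0_iff_vec_prod_zero_field[OF M] by blast
  have "g \<bullet> c = 0" if g: "g \<in> set gs" for g
  proof -
    obtain i where i: "i < length gs" "g = gs ! i" using g by (metis in_set_conv_nth)
    have "g \<in> carrier_vec n" using g gs by blast
    then have "row M i = g"
      using i len by (intro eq_vecI) (auto simp: M_def)
    then show ?thesis
      using arg_cong[OF c(3), of "\<lambda>u. u $ i"] i len M by simp
  qed
  with c show ?thesis by blast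
qed

lemma proots_prod_linear:
  "proots (\<Prod>a \<leftarrow> as. [:- a, 1:]) = mset (as :: 'a :: idom list)"
proof (induction as)
  case (Cons a as)
  have "(\<Prod>a \<leftarrow> as. [:- a, 1:]) \<noteq> 0" by (auto simp: prod_list_zero_iff)
  then have "proots ([:- a, 1:] * (\<Prod>a \<leftarrow> as. [:- a, 1:])) = {#a#} + mset as"
    by (subst proots_mult) (auto simp: Cons.IH)
  then show ?case by simp
qed simp

lemma proots_char_poly_diag:
  fixes A :: "'a :: idom mat"
  assumes "similar_mat_wit A (mat_diag n d) P Q"
  shows "proots (char_poly A) = mset (map d [0..<n])"
proof -
  have "char_poly A = char_poly (mat_diag n d)"
    using assms by (intro char_poly_similar) (auto simp: similar_mat_def)
  also have "\<dots> = (\<Prod>a \<leftarrow> diag_mat (mat_diag n d). [:- a, 1:])"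
    by (rule char_poly_upper_triangular[of _ n]) (auto simp: mat_diag_def)
  also have "diag_mat (mat_diag n d) = map d [0..<n]"
    by (auto simp: diag_mat_def mat_diag_def)
  finally show ?thesis by (simp only: proots_prod_linear)
qed

lemma size_proots_symmetric:
  fixes A :: "real mat"
  assumes "A \<in> carrier_mat n n" "transpose_mat A = A"
  shows "size (proots (char_poly A)) = n"
  using symmetric_real_diagonalisation[OF assms] proots_char_poly_diag by fastforce

text \<open>One half of the Courant--Fischer theorem, with the subspace given by linear equations.\<close>

lemma count_eigenvalues_le:
  fixes A :: "real mat" and s t :: real
  assumes A: "A \<in> carrier_mat n n" and sym: "transpose_mat A = A"
    and fs: "set fs \<subseteq> carrier_vec n"
    and le: "\<And>x. x \<in> carrier_vec n \<Longrightarrow> (\<And>f. f \<in> set fs \<Longrightarrow> f \<bullet> x = 0) \<Longrightarrow> s * (x \<bullet> (A *\<^sub>v x)) \<le> t * (x \<bullet> x)"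
  shows "size (filter_mset (\<lambda>e. s * e > t) (proots (char_poly A))) \<le> length fs"
proof (rule ccontr)
  assume gt: "\<not> ?thesis"
  obtain Q d where w: "similar_mat_wit A (mat_diag n d) Q (transpose_mat Q)"
    using symmetric_real_diagonalisation[OF A sym] by blast
  note W = similar_mat_witD2[OF A w]
  let ?big = "filter (\<lambda>i. s * d i > t) [0..<n]" and ?small = "filter (\<lambda>i. \<not> s * d i > t) [0..<n]"
  have "size (filter_mset (\<lambda>e. s * e > t) (proots (char_poly A))) = length ?big"
    unfolding proots_char_poly_diag[OF w]
    by (simp only: size_mset length_map filter_map o_def flip: mset_filter)
  with gt have big: "length ?big > length fs" by simp
  \<comment> \<open>These are equations for the coordinates \<open>c\<close> of a vector in the
    eigenbasis: \<open>c\<close> vanishes at all small eigenvalues, and \<open>Q c\<close> satisfies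
    the constraints \<open>fs\<close>. There are fewer than \<open>n\<close> of them, so a nonzero
    solution exists; being supported on large eigenvalues, it violates \<open>le\<close>.\<close>
  define gs where "gs = map (unit_vec n) ?small @ map (\<lambda>f. transpose_mat Q *\<^sub>v f) fs"
  have "length ?big + length ?small = n" using sum_length_filter_compl[of _ "[0..<n]"] by simp
  then have "length gs < n" using big by (simp add: gs_def)
  moreover have "set gs \<subseteq> carrier_vec n" using fs W by (auto simp: gs_def)
  ultimately obtain c where c: "c \<in> carrier_vec n" "c \<noteq> 0\<^sub>v n" and gc: "\<And>g. g \<in> set gs \<Longrightarrow> g \<bullet> c = 0"
    using exists_common_zero by blast
  have c0: "c $ i = 0" if "i < n" "\<not> s * d i > t" for i
    using gc[of "unit_vec n i"] that c(1) by (auto simp: gs_def)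
  define x where "x = Q *\<^sub>v c"
  have x: "x \<in> carrier_vec n" using W c by (simp add: x_def)
  have Qx: "transpose_mat Q *\<^sub>v x = c"
    using W c by (simp add: x_def flip: assoc_mult_mat_vec[of _ n n _ n])
  have "f \<bullet> x = 0" if f: "f \<in> set fs" for f
  proof -
    have "f \<in> carrier_vec n" using f fs by blast
    then show ?thesis
      using gc[of "transpose_mat Q *\<^sub>v f"] f W(6) c(1)
        transpose_vec_mult_scalar[of Q n n c f]
      by (auto simp: gs_def x_def)
  qed
  then have *: "s * (x \<bullet> (A *\<^sub>v x)) \<le> t * (x \<bullet> x)" by (intro le x)
  have "x \<bullet> x = (transpose_mat Q *\<^sub>v x) \<bullet> c"
    using transpose_vec_mult_scalar[of Q n n c x] W c x by (simp add: x_def)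
  then have xx: "x \<bullet> x = (\<Sum>i<n. c $ i * c $ i)"
    using c by (simp add: Qx scalar_prod_def atLeast0LessThan)
  have "Q * mat_diag n d \<in> carrier_mat n n" using W by simp
  then have "A *\<^sub>v x = Q *\<^sub>v (mat_diag n d *\<^sub>v c)"
    unfolding W(3) using W(6,7) c x Qx by (simp only: assoc_mult_mat_vec[of _ n n _ n] mat_diag_dim)
  then have "x \<bullet> (A *\<^sub>v x) = c \<bullet> (mat_diag n d *\<^sub>v c)"
    using transpose_vec_mult_scalar[of Q n n "mat_diag n d *\<^sub>v c" x] W c x
    by (simp add: Qx mult_mat_vec_carrier[of _ n n])
  also have "mat_diag n d *\<^sub>v c = vec n (\<lambda>i. d i * c $ i)"
  proof (rule eq_vecI)
    fix i assume "i < dim_vec (vec n (\<lambda>i. d i * c $ i))"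
    then have i: "i < n" by simp
    then have "(mat_diag n d *\<^sub>v c) $ i = (\<Sum>j<n. (if i = j then d j else 0) * c $ j)"
      using c by (simp add: mat_diag_def scalar_prod_def atLeast0LessThan)
    also have "\<dots> = (\<Sum>j<n. if j = i then d i * c $ i else 0)"
      by (rule sum.cong) auto
    finally show "(mat_diag n d *\<^sub>v c) $ i = vec n (\<lambda>i. d i * c $ i) $ i"
      using i by simp
  qed (simp add: mat_diag_def)
  finally have xAx: "x \<bullet> (A *\<^sub>v x) = (\<Sum>i<n. d i * (c $ i * c $ i))"
    by (simp add: scalar_prod_def atLeast0LessThan ac_simps)
  have "(\<Sum>i<n. (s * d i - t) * (c $ i * c $ i)) > 0"
  proof -
    obtain i where i: "i < n" "c $ i \<noteq> 0"
      using c by (metis carrier_vecD eq_vecI index_zero_vec)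
    show ?thesis
    proof (rule sum_pos2[of _ i])
      show "0 < (s * d i - t) * (c $ i * c $ i)"
      proof (rule mult_pos_pos)
        show "0 < s * d i - t" using c0[of i] i by force
        show "0 < c $ i * c $ i" using i(2) not_real_square_gt_zero by blast
      qed
      show "0 \<le> (s * d j - t) * (c $ j * c $ j)" if "j \<in> {..<n}" for j
        using c0[of j] that by (cases "s * d j > t") auto
    qed (use i in auto)
  qed
  then have "s * (x \<bullet> (A *\<^sub>v x)) - t * (x \<bullet> x) > 0"
    unfolding xx xAx by (simp add: sum_subtractf sum_distrib_left algebra_simps)
  with * show False by simp
qed

text \<open>Positions start at 0: if the entry at position \<open>k\<close> exceeded
  \<open>t\<close>, so would the \<open>k\<close> entries before it, which makes
  \<open>k + 1\<close> of them.\<close>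

lemma rev_sorted_list_of_multiset_le:
  fixes M :: "'a :: linorder multiset"
  assumes "size (filter_mset (\<lambda>e. e > t) M) \<le> k" "k < size M"
  shows "rev (sorted_list_of_multiset M) ! k \<le> t"
proof (rule ccontr)
  assume neg: "\<not> ?thesis"
  define L where "L = rev (sorted_list_of_multiset M)"
  have sorted: "sorted_wrt (\<ge>) L" by (simp add: L_def sorted_wrt_rev)
  have M: "mset L = M" by (simp add: L_def)
  then have len: "length L = size M" by (metis size_mset)
  have "L ! i > t" if "i \<le> k" for i
    using sorted_wrt_nth_less[OF sorted, of i k] that neg assms(2) len
    by (cases "i = k") (auto simp: L_def)
  then have "{..k} \<subseteq> {i. i < length L \<and> L ! i > t}" using assms(2) len by auto
  then have "card {..k} \<le> card {i. i < length L \<and> L ! i > t}" by (intro card_mono) auto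
  also have "\<dots> = size (filter_mset (\<lambda>e. e > t) M)"
    by (simp only: M[symmetric] mset_filter[symmetric] size_mset length_filter_conv_card)
  finally show False using assms(1) by simp
qed

text \<open>Position \<open>size M - 1 - k\<close> in the reversed list is position \<open>k\<close>
  in the increasing one, where the same count applies from below.\<close>

lemma rev_sorted_list_of_multiset_ge:
  fixes M :: "'a :: linorder multiset"
  assumes "size (filter_mset (\<lambda>e. e < t) M) \<le> k" "k < size M"
  shows "rev (sorted_list_of_multiset M) ! (size M - 1 - k) \<ge> t"
proof (rule ccontr)
  assume neg: "\<not> ?thesis"
  define L where "L = sorted_list_of_multiset M"
  have M: "mset L = M" by (simp add: L_def)
  then have len: "length L = size M" by (metis size_mset)
  have Lk: "L ! k < t"
    using neg assms(2) len by (simp add: rev_nth flip: L_def)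
  have "L ! i < t" if "i \<le> k" for i
    using sorted_nth_mono[of L i k] that Lk assms(2) len by (simp add: L_def)
  then have "{..k} \<subseteq> {i. i < length L \<and> L ! i < t}" using assms(2) len by auto
  then have "card {..k} \<le> card {i. i < length L \<and> L ! i < t}" by (intro card_mono) auto
  also have "\<dots> = size (filter_mset (\<lambda>e. e < t) M)"
    by (simp only: M[symmetric] mset_filter[symmetric] size_mset length_filter_conv_card)
  finally show False using assms(1) by simp
qed

section \<open>Quadratic form and spectrum of a graph\<close>

definition adj_form :: "'a pair_pre_digraph \<Rightarrow> ('a \<Rightarrow> real) \<Rightarrow> real" where
  "adj_form G x = (\<Sum>u \<in> pverts G. \<Sum>v | (u, v) \<in> parcs G. x u * x v)"

context
  fixes G :: "'a pair_pre_digraph"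
  assumes G: "pair_graph G"
begin

interpretation pair_graph G by (fact G)

lemma sum_vertex_enum:
  "(\<Sum>i < order_of G. g (vertex_enum G ! i)) = (\<Sum>v \<in> pverts G. g v)"
proof -
  have "bij_betw (\<lambda>i. vertex_enum G ! i) {..<order_of G} (pverts G)"
    by (rule bij_betw_nth) (auto simp: vertex_enum)
  then show ?thesis by (rule sum.reindex_bij_betw)
qed

lemma adjacency_mat_carrier [simp]: "adjacency_mat G \<in> carrier_mat (order_of G) (order_of G)"
  by (simp add: adjacency_mat_def)

lemma adjacency_mat_symmetric: "transpose_mat (adjacency_mat G) = adjacency_mat G"
  by (rule eq_matI) (auto simp: adjacency_mat_def dest: arcs_symmetric)

lemma adjacency_mat_mult:
  fixes x :: "'a \<Rightarrow> real"
  assumes "i < order_of G"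
  shows "(adjacency_mat G *\<^sub>v vec (order_of G) (\<lambda>i. x (vertex_enum G ! i))) $ i
    = (\<Sum>v | (vertex_enum G ! i, v) \<in> parcs G. x v)"
proof -
  let ?u = "vertex_enum G ! i"
  have "(adjacency_mat G *\<^sub>v vec (order_of G) (\<lambda>i. x (vertex_enum G ! i))) $ i
      = (\<Sum>j < order_of G. (\<lambda>v. if (?u, v) \<in> parcs G then x v else 0) (vertex_enum G ! j))"
    using assms by (auto simp: adjacency_mat_def scalar_prod_def atLeast0LessThan intro!: sum.cong)
  also have "\<dots> = (\<Sum>v \<in> pverts G. if (?u, v) \<in> parcs G then x v else 0)"
    by (rule sum_vertex_enum)
  also have "\<dots> = (\<Sum>v \<in> {v \<in> pverts G. (?u, v) \<in> parcs G}. x v)"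
    by (simp add: sum.inter_filter)
  also have "{v \<in> pverts G. (?u, v) \<in> parcs G} = {v. (?u, v) \<in> parcs G}"
    using in_arcsD2 by auto
  finally show ?thesis .
qed

lemma vec_vertex_enum:
  assumes "c \<in> carrier_vec (order_of G)"
  obtains x where "c = vec (order_of G) (\<lambda>i. x (vertex_enum G ! i))"
proof
  have inj: "inj_on (\<lambda>i. vertex_enum G ! i) {..<order_of G}"
    by (rule inj_on_nth) (auto simp: vertex_enum)
  show "c = vec (order_of G)
      (\<lambda>i. (\<lambda>v. c $ inv_into {..<order_of G} (\<lambda>i. vertex_enum G ! i) v) (vertex_enum G ! i))"
    using assms by (intro eq_vecI) (auto simp: inv_into_f_f[OF inj])
qed

text \<open>This carries the Courant--Fischer bound over to functions on vertices, so that the graph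
  arguments never mention the enumeration behind the matrix.\<close>

lemma count_adjacency_eigenvalues_le:
  fixes F :: "('a \<Rightarrow> real) list"
  assumes le: "\<And>x. (\<And>f. f \<in> set F \<Longrightarrow> (\<Sum>v \<in> pverts G. f v * x v) = 0) \<Longrightarrow>
    s * adj_form G x \<le> t * (\<Sum>v \<in> pverts G. (x v)\<^sup>2)"
  shows "size (filter_mset (\<lambda>e. s * e > t) (proots (char_poly (adjacency_mat G)))) \<le> length F"
proof -
  let ?n = "order_of G" and ?vs = "vertex_enum G"
  let ?vec = "\<lambda>x :: 'a \<Rightarrow> real. vec ?n (\<lambda>i. x (?vs ! i))"
  have sp: "?vec f \<bullet> ?vec x = (\<Sum>v \<in> pverts G. f v * x v)" for f x
    by (simp add: scalar_prod_def atLeast0LessThan sum_vertex_enum[of "\<lambda>v. f v * x v"])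
  have "size (filter_mset (\<lambda>e. s * e > t) (proots (char_poly (adjacency_mat G)))) \<le> length (map ?vec F)"
  proof (rule count_eigenvalues_le[OF adjacency_mat_carrier adjacency_mat_symmetric])
    fix c assume c: "c \<in> carrier_vec ?n" and Fc: "\<And>f. f \<in> set (map ?vec F) \<Longrightarrow> f \<bullet> c = 0"
    obtain x where x: "c = ?vec x" using c by (rule vec_vertex_enum)
    have "c \<bullet> (adjacency_mat G *\<^sub>v c) = (\<Sum>i<?n. x (?vs ! i) * (adjacency_mat G *\<^sub>v ?vec x) $ i)"
      by (simp add: x scalar_prod_def atLeast0LessThan adjacency_mat_def)
    also have "\<dots> = (\<Sum>i<?n. (\<lambda>u. x u * (\<Sum>v | (u, v) \<in> parcs G. x v)) (?vs ! i))"
      by (intro sum.cong) (auto simp: adjacency_mat_mult)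
    also have "\<dots> = adj_form G x"
      by (subst sum_vertex_enum) (simp add: adj_form_def sum_distrib_left)
    finally have "c \<bullet> (adjacency_mat G *\<^sub>v c) = adj_form G x" .
    moreover have "s * adj_form G x \<le> t * (\<Sum>v \<in> pverts G. (x v)\<^sup>2)"
      by (rule le) (use Fc in \<open>auto simp: x simp flip: sp\<close>)
    ultimately show "s * (c \<bullet> (adjacency_mat G *\<^sub>v c)) \<le> t * (c \<bullet> c)"
      by (simp add: x sp power2_eq_square)
  qed auto
  then show ?thesis by simp
qed

lemma adjacency_eigenvector:
  assumes "e \<in># proots (char_poly (adjacency_mat G))"
  obtains x where "\<exists>v \<in> pverts G. x v \<noteq> 0"
    "\<And>u. u \<in> pverts G \<Longrightarrow> (\<Sum>v | (u, v) \<in> parcs G. x v) = e * x u"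
proof -
  let ?n = "order_of G" and ?vs = "vertex_enum G"
  have "char_poly (adjacency_mat G) \<noteq> 0"
    using degree_monic_char_poly[OF adjacency_mat_carrier] by auto
  then have "poly (char_poly (adjacency_mat G)) e = 0"
    using assms by simp
  then obtain c where c: "c \<in> carrier_vec ?n" "c \<noteq> 0\<^sub>v ?n" "adjacency_mat G *\<^sub>v c = e \<cdot>\<^sub>v c"
    using eigenvalue_root_char_poly[OF adjacency_mat_carrier]
    unfolding eigenvalue_def eigenvector_def by (auto simp: adjacency_mat_def)
  obtain x where x: "c = vec ?n (\<lambda>i. x (?vs ! i))" using c(1) by (rule vec_vertex_enum)
  obtain i where i: "i < ?n" "c $ i \<noteq> 0" using c by (metis carrier_vecD eq_vecI index_zero_vec)
  have mem: "?vs ! i \<in> pverts G" if "i < ?n" for i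
    using that vertex_enum(2,3)[of G] nth_mem[of i ?vs] by simp
  show thesis
  proof
    show "\<exists>v \<in> pverts G. x v \<noteq> 0" using i mem[OF i(1)] x by auto
    fix u assume "u \<in> pverts G"
    then have "u \<in> set ?vs" by (simp add: vertex_enum)
    then obtain j where j: "j < ?n" "u = ?vs ! j"
      unfolding in_set_conv_nth by (auto simp: vertex_enum)
    show "(\<Sum>v | (u, v) \<in> parcs G. x v) = e * x u"
      using arg_cong[OF c(3), of "\<lambda>w. w $ j"] j by (simp add: x adjacency_mat_mult)
  qed
qed

lemma size_eigenvalues: "size (proots (char_poly (adjacency_mat G))) = order_of G"
  by (rule size_proots_symmetric[OF adjacency_mat_carrier adjacency_mat_symmetric])

text \<open>In zero-based positions the medians sit at \<open>k\<close> and at the mirror image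
  \<open>n - 1 - k\<close>, with \<open>k = (n - 1) div 2\<close>. Hence one count, at most
  \<open>k\<close> eigenvalues beyond the bound, serves at both ends.\<close>

lemma H_index_minus_1: "pverts G \<noteq> {} \<Longrightarrow> H_index G - 1 = (order_of G - 1) div 2"
  using floor_divide_of_nat_eq[of "order_of G + 1" 2, where 'a = real]
  by (simp add: H_index_def add.commute)
lemma L_index_minus_1: "pverts G \<noteq> {} \<Longrightarrow> L_index G - 1 = order_of G - 1 - (order_of G - 1) div 2"
proof -
  have "\<lceil>(real n + 1) / 2\<rceil> = int (n div 2 + 1)" for n
    by (cases "even n") (auto elim!: evenE oddE simp: ceiling_eq_iff field_simps)
  then show ?thesis by (simp add: L_index_def)
qed

end

section \<open>Optimal cuts of subcubic graphs\<close>

locale subcubic_graph =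
  fixes V :: "'a set" and E :: "('a \<times> 'a) set"
  assumes finite_V: "finite V"
    and E_subset: "E \<subseteq> V \<times> V"
    and E_sym: "(u, v) \<in> E \<Longrightarrow> (v, u) \<in> E"
    and E_irrefl: "(v, v) \<notin> E"
    and degree_le: "v \<in> V \<Longrightarrow> card {w. (v, w) \<in> E} \<le> 3"
begin

definition nbrs :: "'a \<Rightarrow> 'a set" where
  "nbrs v = {w. (v, w) \<in> E}"

definition form :: "('a \<Rightarrow> real) \<Rightarrow> real" where
  "form x = (\<Sum>v \<in> V. \<Sum>w \<in> nbrs v. x v * x w)"

text \<open>A colouring \<open>\<sigma>\<close> stands for the cut between its two colour classes.\<close>

definition own :: "('a \<Rightarrow> bool) \<Rightarrow> 'a \<Rightarrow> 'a set" where
  "own \<sigma> v = {w \<in> nbrs v. \<sigma> w = \<sigma> v}"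

definition cross :: "('a \<Rightarrow> bool) \<Rightarrow> 'a \<Rightarrow> 'a set" where
  "cross \<sigma> v = {w \<in> nbrs v. \<sigma> w \<noteq> \<sigma> v}"

definition cls :: "('a \<Rightarrow> bool) \<Rightarrow> bool \<Rightarrow> 'a set" where
  "cls \<sigma> c = {v \<in> V. \<sigma> v = c}"

text \<open>Each monochromatic edge counts twice, once from either end; this is why a change by one
  edge appears as 2 below.\<close>

definition mono_count :: "('a \<Rightarrow> bool) \<Rightarrow> nat" where
  "mono_count \<sigma> = (\<Sum>v \<in> V. card (own \<sigma> v))"

definition optimal :: "('a \<Rightarrow> bool) \<Rightarrow> bool" where
  "optimal \<sigma> \<longleftrightarrow> (\<forall>\<tau>. mono_count \<sigma> \<le> mono_count \<tau>)"

definition flip :: "'a \<Rightarrow> ('a \<Rightarrow> bool) \<Rightarrow> 'a \<Rightarrow> bool" where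
  "flip v \<sigma> = \<sigma>(v := \<not> \<sigma> v)"

lemma nbrs_subset: "nbrs v \<subseteq> V"
  using E_subset by (auto simp: nbrs_def)

lemma in_V: "w \<in> nbrs v \<Longrightarrow> v \<in> V \<and> w \<in> V"
  using E_subset by (auto simp: nbrs_def)

lemma finite_nbrs [simp]: "finite (nbrs v)"
  using nbrs_subset finite_V finite_subset by blast

lemma nbrs_sym: "w \<in> nbrs v \<longleftrightarrow> v \<in> nbrs w"
  using E_sym by (auto simp: nbrs_def)

lemma nbrs_irrefl [simp]: "v \<notin> nbrs v"
  using E_irrefl by (auto simp: nbrs_def)

lemma card_nbrs_le: "card (nbrs v) \<le> 3"
proof (cases "v \<in> V")
  case True
  then show ?thesis using degree_le by (simp add: nbrs_def)
next
  case False
  then have "nbrs v = {}" using in_V by blast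
  then show ?thesis by simp
qed

lemma finite_own [simp]: "finite (own \<sigma> v)" and finite_cross [simp]: "finite (cross \<sigma> v)"
  by (auto simp: own_def cross_def)

lemma own_irrefl [simp]: "v \<notin> own \<sigma> v"
  by (auto simp: own_def)

lemma own_sym: "w \<in> own \<sigma> v \<longleftrightarrow> v \<in> own \<sigma> w"
  using nbrs_sym by (auto simp: own_def)

lemma cross_sym: "w \<in> cross \<sigma> v \<longleftrightarrow> v \<in> cross \<sigma> w"
  using nbrs_sym by (auto simp: cross_def)

lemma nbrs_own_cross: "nbrs v = own \<sigma> v \<union> cross \<sigma> v"
  by (auto simp: own_def cross_def)

lemma card_own_cross: "card (own \<sigma> v) + card (cross \<sigma> v) = card (nbrs v)"
  unfolding nbrs_own_cross[of v \<sigma>]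
  by (rule card_Un_disjoint[symmetric]) (auto simp: own_def cross_def)

lemma finite_cls [simp]: "finite (cls \<sigma> c)"
  using finite_V by (simp add: cls_def)

lemma own_cls: "v \<in> cls \<sigma> c \<Longrightarrow> own \<sigma> v \<subseteq> cls \<sigma> c"
  using nbrs_subset by (auto simp: own_def cls_def)

lemma cross_cls: "v \<in> cls \<sigma> c \<Longrightarrow> cross \<sigma> v \<subseteq> cls \<sigma> (\<not> c)"
  using nbrs_subset by (auto simp: cross_def cls_def)

lemma V_cls: "V = cls \<sigma> c \<union> cls \<sigma> (\<not> c)" "cls \<sigma> c \<inter> cls \<sigma> (\<not> c) = {}"
  by (auto simp: cls_def)

lemma card_cls: "card (cls \<sigma> c) + card (cls \<sigma> (\<not> c)) = card V"
  using card_Un_disjoint[OF finite_cls finite_cls V_cls(2)] V_cls(1)[of \<sigma> c] by metis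

text \<open>A flip exchanges \<open>own\<close> and \<open>cross\<close> at \<open>v\<close>, and
  each neighbour of \<open>v\<close> gains or loses \<open>v\<close> accordingly, which doubles the
  change. Terms stand on both sides to avoid subtraction of naturals.\<close>

lemma mono_count_flip:
  assumes v: "v \<in> V"
  shows "mono_count (flip v \<sigma>) + 2 * card (own \<sigma> v) = mono_count \<sigma> + 2 * card (cross \<sigma> v)"
proof -
  let ?\<tau> = "flip v \<sigma>"
  have own_v: "own ?\<tau> v = cross \<sigma> v"
    by (auto simp: own_def cross_def flip_def)
  have other: "card (own ?\<tau> x) + of_bool (x \<in> own \<sigma> v) = card (own \<sigma> x) + of_bool (x \<in> cross \<sigma> v)"
    if x: "x \<noteq> v" for x
  proof -
    consider "x \<in> own \<sigma> v" | "x \<in> cross \<sigma> v" | "x \<notin> nbrs v"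
      by (auto simp: own_def cross_def)
    then show ?thesis
    proof cases
      case 1
      then have "own \<sigma> x = insert v (own ?\<tau> x)" "v \<notin> own ?\<tau> x" "x \<notin> cross \<sigma> v"
        using x nbrs_sym[of x v] by (auto simp: own_def cross_def flip_def)
      then show ?thesis using 1 by simp
    next
      case 2
      then have "own ?\<tau> x = insert v (own \<sigma> x)" "v \<notin> own \<sigma> x" "x \<notin> own \<sigma> v"
        using x nbrs_sym[of x v] by (auto simp: own_def cross_def flip_def)
      then show ?thesis using 2 by simp
    next
      case 3
      then have "own ?\<tau> x = own \<sigma> x" "x \<notin> own \<sigma> v" "x \<notin> cross \<sigma> v"
        using x nbrs_sym[of x v] by (auto simp: own_def cross_def flip_def)
      then show ?thesis by simp
    qed
  qed
  have ind: "(\<Sum>x \<in> V - {v}. of_bool (x \<in> S)) = card S" if "S \<subseteq> V - {v}" for S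
    using that finite_V by (simp add: of_bool_def sum.If_cases Int_absorb1)
  have sub: "own \<sigma> v \<subseteq> V - {v}" "cross \<sigma> v \<subseteq> V - {v}"
    using nbrs_subset nbrs_irrefl by (auto simp: own_def cross_def)
  have "(\<Sum>x \<in> V - {v}. card (own ?\<tau> x)) + card (own \<sigma> v)
      = (\<Sum>x \<in> V - {v}. card (own ?\<tau> x) + of_bool (x \<in> own \<sigma> v))"
    by (simp only: sum.distrib ind[OF sub(1)])
  also have "\<dots> = (\<Sum>x \<in> V - {v}. card (own \<sigma> x) + of_bool (x \<in> cross \<sigma> v))"
    by (rule sum.cong) (auto simp: other)
  also have "\<dots> = (\<Sum>x \<in> V - {v}. card (own \<sigma> x)) + card (cross \<sigma> v)"
    by (simp only: sum.distrib ind[OF sub(2)])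
  finally show ?thesis
    using v finite_V by (simp add: mono_count_def sum.remove[of V v] own_v)
qed

lemma exists_optimal: "\<exists>\<sigma>. optimal \<sigma>"
  using ex_has_least_nat[of "\<lambda>_. True" undefined mono_count] by (auto simp: optimal_def)

text \<open>One neighbour in its own class leaves at most two across, so the flip costs at most one
  edge.\<close>

lemma mono_count_flip_le:
  assumes "w \<in> own \<sigma> v"
  shows "mono_count (flip v \<sigma>) \<le> mono_count \<sigma> + 2"
proof -
  have "card (own \<sigma> v) \<ge> 1"
    using assms by (metis One_nat_def Suc_leI card_gt_0_iff empty_iff finite_own)
  moreover have "v \<in> V" using assms in_V by (auto simp: own_def)
  ultimately show ?thesis
    using mono_count_flip[of v \<sigma>] card_own_cross[of \<sigma> v] card_nbrs_le[of v] by linarith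
qed

text \<open>Two neighbours in its own class leave at most one across, so the flip saves at least one
  edge.\<close>

lemma mono_count_flip_less:
  assumes "a \<in> own \<sigma> v" "b \<in> own \<sigma> v" "a \<noteq> b"
  shows "mono_count (flip v \<sigma>) + 2 \<le> mono_count \<sigma>"
proof -
  have "card {a, b} \<le> card (own \<sigma> v)" using assms by (intro card_mono) auto
  then have "card (own \<sigma> v) \<ge> 2" using assms(3) by simp
  moreover have "v \<in> V" using assms(1) in_V by (auto simp: own_def)
  ultimately show ?thesis
    using mono_count_flip[of v \<sigma>] card_own_cross[of \<sigma> v] card_nbrs_le[of v] by linarith
qed

text \<open>Otherwise flipping \<open>v\<close> would improve the cut. The monochromatic edges of an
  optimal cut therefore form a matching, and the one element of \<open>own \<sigma> v\<close>, if
  any, is the mate of \<open>v\<close>.\<close>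

lemma optimal_own_unique:
  assumes "optimal \<sigma>" "a \<in> own \<sigma> v" "b \<in> own \<sigma> v"
  shows "a = b"
proof (rule ccontr)
  assume "a \<noteq> b"
  then show False
    using mono_count_flip_less[OF assms(2,3)] assms(1)[unfolded optimal_def, rule_format, of "flip v \<sigma>"]
    by linarith
qed

lemma optimal_own_eq: "optimal \<sigma> \<Longrightarrow> w \<in> own \<sigma> v \<Longrightarrow> own \<sigma> v = {w}"
  using optimal_own_unique by blast

lemma optimal_card_cross:
  assumes "optimal \<sigma>" "w \<in> own \<sigma> v"
  shows "card (cross \<sigma> v) \<le> 2"
  using optimal_own_eq[OF assms] card_own_cross[of \<sigma> v] card_nbrs_le[of v] by simp

lemma flip_swap_own:
  assumes u: "w \<in> cross \<sigma> u" and w: "w' \<in> own \<sigma> w"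
  shows "u \<in> own (flip u \<sigma>) w" "w' \<in> own (flip u \<sigma>) w" "u \<noteq> w'"
  using assms nbrs_sym[of w u] by (auto simp: own_def cross_def flip_def)

text \<open>Flipping \<open>u\<close> costs at most one edge. Afterwards \<open>w\<close> has both
  \<open>u\<close> and \<open>w'\<close> in its class, so flipping \<open>w\<close> regains that
  edge.\<close>

lemma optimal_swap:
  assumes opt: "optimal \<sigma>" and "u' \<in> own \<sigma> u" "w \<in> cross \<sigma> u" "w' \<in> own \<sigma> w"
  shows "optimal (flip w (flip u \<sigma>))"
proof -
  have "mono_count (flip w (flip u \<sigma>)) \<le> mono_count \<sigma>"
    using mono_count_flip_le[OF assms(2)] mono_count_flip_less[OF flip_swap_own[OF assms(3,4)]] by linarith
  then show ?thesis using opt unfolding optimal_def by (meson order_trans)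
qed

text \<open>If \<open>w1\<close> and \<open>w2\<close> were not adjacent, flipping \<open>u\<close>,
  \<open>w1\<close>, \<open>w2\<close> in turn would cost one edge and then save one twice: the mate
  of \<open>w2\<close> is not \<open>w1\<close>, so it keeps its colour, and \<open>w2\<close> still
  has two neighbours in its class when its turn comes.\<close>

lemma optimal_cross_adjacent:
  assumes opt: "optimal \<sigma>" and u': "u' \<in> own \<sigma> u"
    and w: "w1 \<in> cross \<sigma> u" "w2 \<in> cross \<sigma> u" "w1 \<noteq> w2" "own \<sigma> w1 \<noteq> {}" "own \<sigma> w2 \<noteq> {}"
  shows "w2 \<in> own \<sigma> w1"
proof (rule ccontr)
  assume non: "w2 \<notin> own \<sigma> w1"
  obtain v1 v2 where v: "v1 \<in> own \<sigma> w1" "v2 \<in> own \<sigma> w2" using w by blast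
  let ?\<sigma>1 = "flip u \<sigma>" and ?\<sigma>2 = "flip w1 (flip u \<sigma>)"
  have "w1 \<notin> own \<sigma> w2" using non own_sym by blast
  then have "v2 \<noteq> w1" using v by blast
  moreover have "\<sigma> w1 \<noteq> \<sigma> u" "\<sigma> w2 \<noteq> \<sigma> u" "\<sigma> v2 = \<sigma> w2" "v2 \<in> nbrs w2" "u \<in> nbrs w2"
    using w(1,2) v(2) nbrs_sym[of w2 u] by (auto simp: own_def cross_def)
  moreover from this have "w1 \<noteq> u" "w2 \<noteq> u" "v2 \<noteq> u" by metis+
  ultimately have "u \<in> own ?\<sigma>2 w2" "v2 \<in> own ?\<sigma>2 w2" "u \<noteq> v2"
    using w(3) by (simp_all add: own_def flip_def)
  then have "mono_count (flip w2 ?\<sigma>2) + 2 \<le> mono_count ?\<sigma>2"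
    by (rule mono_count_flip_less)
  moreover have "mono_count ?\<sigma>2 + 2 \<le> mono_count ?\<sigma>1"
    by (rule mono_count_flip_less[OF flip_swap_own[OF w(1) v(1)]])
  moreover have "mono_count ?\<sigma>1 \<le> mono_count \<sigma> + 2" by (rule mono_count_flip_le[OF u'])
  moreover have "mono_count \<sigma> \<le> mono_count (flip w2 ?\<sigma>2)" using opt by (simp add: optimal_def)
  ultimately show False by linarith
qed

lemma card_3_contradiction:
  assumes "a \<in> nbrs v" "b \<in> nbrs v" "c \<in> nbrs v" "d \<in> nbrs v" "distinct [a, b, c, d]"
  shows False
proof -
  have "card {a, b, c, d} \<le> card (nbrs v)" using assms by (intro card_mono) auto
  then show False using assms(5) card_nbrs_le[of v] by simp
qed

section \<open>Test subspaces from the cut\<close>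

text \<open>With the eigenvalues listed in non-increasing order, exactly \<open>(card V - 1) div 2\<close> of them precede
  the first median eigenvalue and as many follow the second; \<open>s = 1\<close> bounds the medians from above
  and \<open>s = - 1\<close> from below.\<close>

definition codim_bound :: "real \<Rightarrow> bool" where
  "codim_bound s \<longleftrightarrow> (\<exists>F. length F \<le> (card V - 1) div 2 \<and>
     (\<forall>x. (\<forall>f \<in> set F. (\<Sum>v \<in> V. f v * x v) = 0) \<longrightarrow> s * form x \<le> sqrt 2 * (\<Sum>v \<in> V. (x v)\<^sup>2)))"

lemma sum_own_swap:
  "(\<Sum>v \<in> cls \<sigma> c. \<Sum>w \<in> own \<sigma> v. f v w) = (\<Sum>v \<in> cls \<sigma> c. \<Sum>w \<in> own \<sigma> v. f w v :: real)"
proof -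
  have own_alt: "own \<sigma> v = {w \<in> cls \<sigma> c. w \<in> own \<sigma> v}" if "v \<in> cls \<sigma> c" for v
    using own_cls[OF that] by blast
  have "(\<Sum>v \<in> cls \<sigma> c. \<Sum>w \<in> own \<sigma> v. f v w)
      = (\<Sum>v \<in> cls \<sigma> c. \<Sum>w \<in> {w \<in> cls \<sigma> c. w \<in> own \<sigma> v}. f v w)"
    using own_alt by (intro sum.cong) auto
  also have "\<dots> = (\<Sum>v \<in> cls \<sigma> c. \<Sum>w \<in> {w \<in> cls \<sigma> c. v \<in> own \<sigma> w}. f w v)"
    by (rule sum.swap_restrict) auto
  also have "\<dots> = (\<Sum>v \<in> cls \<sigma> c. \<Sum>w \<in> {w \<in> cls \<sigma> c. w \<in> own \<sigma> v}. f w v)"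
    using own_sym by (intro sum.cong) auto
  also have "\<dots> = (\<Sum>v \<in> cls \<sigma> c. \<Sum>w \<in> own \<sigma> v. f w v)"
    using own_alt by (intro sum.cong) auto
  finally show ?thesis .
qed

lemma form_split:
  "form x = (\<Sum>v \<in> cls \<sigma> c. \<Sum>w \<in> own \<sigma> v. x v * x w) + (\<Sum>v \<in> cls \<sigma> (\<not> c). \<Sum>w \<in> own \<sigma> v. x v * x w)
    + 2 * (\<Sum>v \<in> cls \<sigma> (\<not> c). x v * (\<Sum>w \<in> cross \<sigma> v. x w))"
proof -
  have nb: "(\<Sum>w \<in> nbrs v. x v * x w) = (\<Sum>w \<in> own \<sigma> v. x v * x w) + (\<Sum>w \<in> cross \<sigma> v. x v * x w)" for v
    unfolding nbrs_own_cross[of v \<sigma>]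
    by (rule sum.union_disjoint) (auto simp: own_def cross_def)
  have alt: "cross \<sigma> v = {w \<in> cls \<sigma> (\<not> d). w \<in> cross \<sigma> v}" if "v \<in> cls \<sigma> d" for v d
    using cross_cls[OF that] by blast
  have "(\<Sum>v \<in> cls \<sigma> c. \<Sum>w \<in> cross \<sigma> v. x v * x w)
      = (\<Sum>v \<in> cls \<sigma> c. \<Sum>w \<in> {w \<in> cls \<sigma> (\<not> c). w \<in> cross \<sigma> v}. x v * x w)"
    using alt by (intro sum.cong) auto
  also have "\<dots> = (\<Sum>w \<in> cls \<sigma> (\<not> c). \<Sum>v \<in> {v \<in> cls \<sigma> c. w \<in> cross \<sigma> v}. x v * x w)"
    by (rule sum.swap_restrict) auto
  also have "\<dots> = (\<Sum>w \<in> cls \<sigma> (\<not> c). \<Sum>v \<in> {v \<in> cls \<sigma> (\<not> \<not> c). v \<in> cross \<sigma> w}. x w * x v)"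
    using cross_sym by (intro sum.cong) (auto simp: mult.commute)
  also have "\<dots> = (\<Sum>w \<in> cls \<sigma> (\<not> c). \<Sum>v \<in> cross \<sigma> w. x w * x v)"
    using alt[of _ "\<not> c"] by (intro sum.cong) auto
  finally have *: "(\<Sum>v \<in> cls \<sigma> c. \<Sum>w \<in> cross \<sigma> v. x v * x w)
    = (\<Sum>w \<in> cls \<sigma> (\<not> c). \<Sum>v \<in> cross \<sigma> w. x w * x v)" .
  have "form x = (\<Sum>v \<in> cls \<sigma> c. \<Sum>w \<in> nbrs v. x v * x w) + (\<Sum>v \<in> cls \<sigma> (\<not> c). \<Sum>w \<in> nbrs v. x v * x w)"
    unfolding form_def
    by (subst V_cls(1)[of \<sigma> c], rule sum.union_disjoint) (use V_cls(2)[of \<sigma> c] in auto)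
  then show ?thesis
    by (simp add: nb sum.distrib * sum_distrib_left)
qed

lemma sum_V_cls: "(\<Sum>v \<in> V. g v) = (\<Sum>v \<in> cls \<sigma> c. g v) + (\<Sum>v \<in> cls \<sigma> (\<not> c). g v :: real)"
  by (subst V_cls(1)[of \<sigma> c], rule sum.union_disjoint) (use V_cls(2)[of \<sigma> c] in auto)

text \<open>The matching splits a class into blocks of one or two vertices, so positivity need only
  be checked on blocks.\<close>

lemma sum_pairs_nonneg:
  assumes opt: "optimal \<sigma>"
    and single: "\<And>v. v \<in> cls \<sigma> c \<Longrightarrow> own \<sigma> v = {} \<Longrightarrow> T v \<ge> 0"
    and pair: "\<And>v w. v \<in> cls \<sigma> c \<Longrightarrow> w \<in> own \<sigma> v \<Longrightarrow> T v + T w \<ge> 0"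
  shows "(\<Sum>v \<in> cls \<sigma> c. T v :: real) \<ge> 0"
proof -
  \<comment> \<open>The involution sends a vertex to its mate and fixes unmatched vertices. Summing
    \<open>T v + T (\<mu> v)\<close> counts everything twice and avoids choosing an end of each
    edge.\<close>
  define \<mu> where "\<mu> v = (if own \<sigma> v = {} then v else the_elem (own \<sigma> v))" for v
  have \<mu>_own: "\<mu> v = w" if "w \<in> own \<sigma> v" for v w
    using that by (simp add: \<mu>_def optimal_own_eq[OF opt that])
  have \<mu>_none: "\<mu> v = v" if "own \<sigma> v = {}" for v using that by (simp add: \<mu>_def)
  have \<mu>: "\<mu> (\<mu> v) = v \<and> \<mu> v \<in> cls \<sigma> c" if "v \<in> cls \<sigma> c" for v
  proof (cases "own \<sigma> v = {}")
    case False
    then obtain w where w: "w \<in> own \<sigma> v" by blast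
    then have "v \<in> own \<sigma> w" using own_sym by blast
    then show ?thesis using \<mu>_own w own_cls[OF that] by auto
  qed (use that \<mu>_none in auto)
  have "(\<Sum>v \<in> cls \<sigma> c. T (\<mu> v)) = (\<Sum>v \<in> cls \<sigma> c. T v)"
    by (rule sum.reindex_bij_betw, rule bij_betw_byWitness[where f' = \<mu>]) (use \<mu> in auto)
  then have "2 * (\<Sum>v \<in> cls \<sigma> c. T v) = (\<Sum>v \<in> cls \<sigma> c. T v + T (\<mu> v))"
    by (simp add: sum.distrib)
  also have "\<dots> \<ge> 0"
  proof (rule sum_nonneg)
    fix v assume v: "v \<in> cls \<sigma> c"
    show "0 \<le> T v + T (\<mu> v)"
      using single[OF v] pair[OF v] \<mu>_own[of _ v] \<mu>_none[of v] by (cases "own \<sigma> v = {}") auto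
  qed
  finally show ?thesis by simp
qed

text \<open>Setting all coordinates on the smaller class to zero uses few enough equations. What
  remains is the form of a matching, bounded by the squared norm because of
  \<open>(x v - s * x w)\<^sup>2 \<ge> 0\<close>.\<close>

lemma unbalanced_codim_bound:
  assumes opt: "optimal \<sigma>" and s: "\<bar>s\<bar> = 1" and unbal: "2 * card (cls \<sigma> c) < card V"
  shows "codim_bound s"
proof -
  obtain as where as: "set as = cls \<sigma> c" "distinct as"
    using finite_distinct_list[OF finite_cls] by blast
  then have len: "length as = card (cls \<sigma> c)" using distinct_card by fastforce
  define F where "F = map (\<lambda>a v. of_bool (v = a) :: real) as"
  have "length F \<le> (card V - 1) div 2" using unbal by (simp add: F_def len)
  moreover have "s * form x \<le> sqrt 2 * (\<Sum>v \<in> V. (x v)\<^sup>2)"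
    if x: "\<forall>f \<in> set F. (\<Sum>v \<in> V. f v * x v) = 0" for x
  proof -
    have x0: "x a = 0" if a: "a \<in> cls \<sigma> c" for a
    proof -
      have "(\<Sum>v \<in> V. of_bool (v = a) * x v) = 0" using x a as by (auto simp: F_def)
      moreover have "(\<Sum>v \<in> V. of_bool (v = a) * x v) = x a"
        using a finite_V by (subst sum.remove[of V a]) (auto simp: cls_def)
      ultimately show ?thesis by simp
    qed
    have "(\<Sum>v \<in> cls \<sigma> (\<not> c). (x v)\<^sup>2 - (\<Sum>w \<in> own \<sigma> v. s * (x v * x w))) \<ge> 0"
    proof (rule sum_pairs_nonneg[OF opt])
      fix v w assume "w \<in> own \<sigma> v"
      then have "own \<sigma> v = {w}" "own \<sigma> w = {v}" using optimal_own_eq[OF opt] own_sym by blast+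
      moreover have "(x v)\<^sup>2 + (x w)\<^sup>2 - 2 * s * x v * x w = (x v - s * x w)\<^sup>2"
        using s by (auto simp: abs_if power2_eq_square algebra_simps split: if_splits)
      ultimately show "0 \<le> (x v)\<^sup>2 - (\<Sum>w \<in> own \<sigma> v. s * (x v * x w)) +
          ((x w)\<^sup>2 - (\<Sum>v \<in> own \<sigma> w. s * (x w * x v)))"
        using zero_le_power2[of "x v - s * x w"] by (simp add: algebra_simps)
    qed auto
    moreover have "s * form x = (\<Sum>v \<in> cls \<sigma> (\<not> c). \<Sum>w \<in> own \<sigma> v. s * (x v * x w))"
    proof -
      have "x w = 0" if "v \<in> cls \<sigma> (\<not> c)" "w \<in> cross \<sigma> v" for v w
        using that cross_cls[of v \<sigma> "\<not> c"] x0 by auto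
      then show ?thesis
        unfolding form_split[of x \<sigma> c] by (simp add: x0 sum_distrib_left)
    qed
    ultimately have "s * form x \<le> (\<Sum>v \<in> cls \<sigma> (\<not> c). (x v)\<^sup>2)"
      by (simp add: sum_subtractf)
    also have "\<dots> = (\<Sum>v \<in> V. (x v)\<^sup>2)"
      by (simp add: sum_V_cls[of _ \<sigma> c] x0)
    also have "\<dots> \<le> sqrt 2 * (\<Sum>v \<in> V. (x v)\<^sup>2)"
      using mult_right_mono[of 1 "sqrt 2" "\<Sum>v \<in> V. (x v)\<^sup>2"] by (simp add: sum_nonneg)
    finally show ?thesis .
  qed
  ultimately show ?thesis unfolding codim_bound_def by blast
qed

text \<open>The diagonal entry at \<open>v\<close> of the inverse of \<open>sqrt 2 - s M\<close>,
  with \<open>M\<close> the matching matrix. It is the same for \<open>s = 1\<close> and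
  \<open>s = - 1\<close>.\<close>

definition weight :: "('a \<Rightarrow> bool) \<Rightarrow> 'a \<Rightarrow> real" where
  "weight \<sigma> v = (if own \<sigma> v = {} then sqrt 2 / 2 else sqrt 2)"

text \<open>The subspace consists of all vectors whose restriction to the class \<open>c\<close> is a multiple of \<open>y\<close>.
  Let \<open>M\<close> be the adjacency matrix of the matching formed by the monochromatic edges of the other
  class. The left-hand side of \<open>crit\<close> is \<open>w\<^sup>T (sqrt 2 - s M)\<inverse> w\<close>, where
  \<open>(sqrt 2 - s M)\<inverse>\<close> has the blocks \<open>1 / sqrt 2\<close> and \<open>((sqrt 2, s), (s, sqrt 2))\<close>.\<close>

lemma schur_criterion:
  assumes opt: "optimal \<sigma>" and s: "\<bar>s\<bar> = 1" and bal: "2 * card (cls \<sigma> c) = card V"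
    and u: "u \<in> cls \<sigma> c" "y u \<noteq> 0"
    and w: "\<And>v. v \<in> cls \<sigma> (\<not> c) \<Longrightarrow> w v = (\<Sum>z \<in> cross \<sigma> v. y z)"
    and crit: "(\<Sum>v \<in> cls \<sigma> (\<not> c). weight \<sigma> v * (w v)\<^sup>2 + s * (\<Sum>z \<in> own \<sigma> v. w v * w z))
      \<le> sqrt 2 * (\<Sum>v \<in> cls \<sigma> c. (y v)\<^sup>2) - s * (\<Sum>v \<in> cls \<sigma> c. \<Sum>z \<in> own \<sigma> v. y v * y z)"
  shows "codim_bound s"
proof -
  have rr: "sqrt 2 * (sqrt 2 * e) = 2 * e" for e :: real by simp
  have ss: "s * s = 1" using s by (auto simp: abs_if split: if_splits)
  obtain as where as: "set as = cls \<sigma> c - {u}" "distinct as"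
    using finite_distinct_list[of "cls \<sigma> c - {u}"] by auto
  have "length as = card (cls \<sigma> c - {u})" using as distinct_card by fastforce
  then have len: "length as = card (cls \<sigma> c) - 1" using u by simp
  \<comment> \<open>The equations \<open>y u * x a = y a * x u\<close> force \<open>x\<close> to be
    a multiple of \<open>y\<close> on the class. Leaving out \<open>a = u\<close> makes their number
    half of \<open>card V\<close> minus one, exactly what is allowed.\<close>
  define F where "F = map (\<lambda>a v. y u * of_bool (v = a) - y a * of_bool (v = u)) as"
  have "length F \<le> (card V - 1) div 2" using bal by (auto simp: F_def len)
  moreover have "s * form x \<le> sqrt 2 * (\<Sum>v \<in> V. (x v)\<^sup>2)"
    if x: "\<forall>f \<in> set F. (\<Sum>v \<in> V. f v * x v) = 0" for x
  proof -
    define a where "a = x u / y u"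
    have delta: "(\<Sum>v \<in> V. of_bool (v = z) * x v) = x z" if "z \<in> cls \<sigma> c" for z
      using that finite_V by (subst sum.remove[of V z]) (auto simp: cls_def)
    have xA: "x z = a * y z" if z: "z \<in> cls \<sigma> c" for z
    proof (cases "z = u")
      case False
      then have "(\<Sum>v \<in> V. (y u * of_bool (v = z) - y z * of_bool (v = u)) * x v) = 0"
        using x z as by (auto simp: F_def)
      also have "(\<Sum>v \<in> V. (y u * of_bool (v = z) - y z * of_bool (v = u)) * x v)
          = y u * (\<Sum>v \<in> V. of_bool (v = z) * x v) - y z * (\<Sum>v \<in> V. of_bool (v = u) * x v)"
        by (simp add: sum_distrib_left sum_subtractf algebra_simps)
      finally show ?thesis using u(2) unfolding delta[OF z] delta[OF u(1)] by (simp add: a_def field_simps)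
    qed (use u in \<open>simp add: a_def\<close>)
    \<comment> \<open>The share of vertex \<open>v\<close> in the completed square: on the class
      opposite to \<open>c\<close>, the sum of \<open>T\<close> is the form
      \<open>sqrt 2 - s M\<close> evaluated at \<open>x\<close> minus its minimiser.\<close>
    define T where "T v = sqrt 2 * (x v)\<^sup>2 - s * (\<Sum>z \<in> own \<sigma> v. x v * x z) - 2 * s * a * (w v * x v)
        + a\<^sup>2 * (weight \<sigma> v * (w v)\<^sup>2 + s * (\<Sum>z \<in> own \<sigma> v. w v * w z))" for v
    have T: "(\<Sum>v \<in> cls \<sigma> (\<not> c). T v) \<ge> 0"
    proof (rule sum_pairs_nonneg[OF opt])
      fix v assume "own \<sigma> v = {}"
      then have "T v = sqrt 2 * (x v - s * a * w v * (sqrt 2 / 2))\<^sup>2"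
        using ss by (simp add: T_def weight_def power2_eq_square algebra_simps)
      then show "0 \<le> T v" by simp
    next
      fix v z assume "z \<in> own \<sigma> v"
      then have o: "own \<sigma> v = {z}" "own \<sigma> z = {v}" using optimal_own_eq[OF opt] own_sym by blast+
      let ?p = "x v - a * (s * sqrt 2 * w v + w z)" and ?q = "x z - a * (s * sqrt 2 * w z + w v)"
      \<comment> \<open>With \<open>?p\<close> and \<open>?q\<close> the deviations from the
        minimiser, this is \<open>sqrt 2 * (?p\<^sup>2 + ?q\<^sup>2) - 2 * s * ?p * ?q\<close>,
        rewritten by means of \<open>s * s = 1\<close>.\<close>
      have "T v + T z = (?p - s * ?q)\<^sup>2 + (sqrt 2 - 1) * (?p\<^sup>2 + ?q\<^sup>2)"
        using s o rr by (auto simp: T_def weight_def power2_eq_square algebra_simps abs_if split: if_splits)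
      then show "0 \<le> T v + T z" by simp
    qed
    have cr: "(\<Sum>z \<in> cross \<sigma> v. x z) = a * w v" if v: "v \<in> cls \<sigma> (\<not> c)" for v
      using cross_cls[OF v] by (auto simp: w[OF v] sum_distrib_left xA intro!: sum.cong)
    have own_A: "(\<Sum>v \<in> cls \<sigma> c. \<Sum>z \<in> own \<sigma> v. x v * x z) = a\<^sup>2 * (\<Sum>v \<in> cls \<sigma> c. \<Sum>z \<in> own \<sigma> v. y v * y z)"
      unfolding sum_distrib_left using own_cls
      by (intro sum.cong refl) (auto simp: xA power2_eq_square subset_iff)
    have sq_A: "(\<Sum>v \<in> cls \<sigma> c. (x v)\<^sup>2) = a\<^sup>2 * (\<Sum>v \<in> cls \<sigma> c. (y v)\<^sup>2)"
      unfolding sum_distrib_left by (intro sum.cong refl) (auto simp: xA power_mult_distrib)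
    have "(\<Sum>v \<in> cls \<sigma> (\<not> c). T v)
        = sqrt 2 * (\<Sum>v \<in> cls \<sigma> (\<not> c). (x v)\<^sup>2) - s * (\<Sum>v \<in> cls \<sigma> (\<not> c). \<Sum>z \<in> own \<sigma> v. x v * x z)
          - 2 * s * (\<Sum>v \<in> cls \<sigma> (\<not> c). x v * (a * w v))
          + a\<^sup>2 * (\<Sum>v \<in> cls \<sigma> (\<not> c). weight \<sigma> v * (w v)\<^sup>2 + s * (\<Sum>z \<in> own \<sigma> v. w v * w z))"
      unfolding T_def sum.distrib sum_subtractf sum_distrib_left[symmetric]
      by (simp add: sum_distrib_left mult.assoc mult.left_commute mult.commute)
    also have "\<dots> \<le> sqrt 2 * (\<Sum>v \<in> cls \<sigma> (\<not> c). (x v)\<^sup>2) - s * (\<Sum>v \<in> cls \<sigma> (\<not> c). \<Sum>z \<in> own \<sigma> v. x v * x z)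
          - 2 * s * (\<Sum>v \<in> cls \<sigma> (\<not> c). x v * (a * w v))
          + a\<^sup>2 * (sqrt 2 * (\<Sum>v \<in> cls \<sigma> c. (y v)\<^sup>2) - s * (\<Sum>v \<in> cls \<sigma> c. \<Sum>z \<in> own \<sigma> v. y v * y z))"
      by (intro add_left_mono mult_left_mono crit) simp
    also have "\<dots> = sqrt 2 * (\<Sum>v \<in> V. (x v)\<^sup>2) - s * form x"
      unfolding form_split[of x \<sigma> c] sum_V_cls[of _ \<sigma> c] own_A sq_A
      using cr by (simp add: algebra_simps)
    finally show ?thesis using T by linarith
  qed
  ultimately show ?thesis unfolding codim_bound_def by blast
qed

text \<open>The entry at \<open>(u, u')\<close> of \<open>N (sqrt 2 - s M)\<inverse> N\<^sup>T\<close>, where \<open>N\<close> is the biadjacency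
  matrix of the cut.\<close>

definition schur :: "('a \<Rightarrow> bool) \<Rightarrow> real \<Rightarrow> 'a \<Rightarrow> 'a \<Rightarrow> real" where
  "schur \<sigma> s u u' = (\<Sum>v \<in> cross \<sigma> u. of_bool (v \<in> cross \<sigma> u') * weight \<sigma> v + s * card (own \<sigma> v \<inter> cross \<sigma> u'))"

lemma sum_of_bool_mult:
  assumes "finite A"
  shows "(\<Sum>v \<in> A. of_bool (v \<in> B) * f v) = (\<Sum>v \<in> A \<inter> B. f v :: real)"
  using assms by (simp add: of_bool_def if_distrib[of "\<lambda>x. x * _"] sum.If_cases Int_def cong: if_cong)

lemma schur_alt:
  assumes u: "u \<in> cls \<sigma> c"
  shows "schur \<sigma> s u u' = (\<Sum>v \<in> cls \<sigma> (\<not> c). of_bool (v \<in> cross \<sigma> u) *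
    (weight \<sigma> v * of_bool (v \<in> cross \<sigma> u') + s * (\<Sum>z \<in> own \<sigma> v. of_bool (z \<in> cross \<sigma> u'))))"
proof -
  have "cls \<sigma> (\<not> c) \<inter> cross \<sigma> u = cross \<sigma> u" using cross_cls[OF u] by blast
  moreover have "(\<Sum>z \<in> own \<sigma> v. of_bool (z \<in> B)) = real (card (own \<sigma> v \<inter> B))" for v B
    using sum_of_bool_mult[of "own \<sigma> v" B "\<lambda>_. 1"] by simp
  ultimately show ?thesis
    by (simp add: sum_of_bool_mult schur_def mult.commute)
qed

lemma sum_two_points:
  fixes f :: "'a \<Rightarrow> real"
  assumes "finite A" "u \<in> A" "u' \<in> A"
  shows "(\<Sum>v \<in> A. (of_bool (v = u) + t * of_bool (v = u')) * f v) = f u + t * f u'" (is "?l = _")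
proof -
  have "?l = (\<Sum>v \<in> A. if v = u then f v else 0) + t * (\<Sum>v \<in> A. if v = u' then f v else 0)"
    unfolding sum_distrib_left sum.distrib[symmetric] by (intro sum.cong) (auto simp: algebra_simps)
  then show ?thesis using assms by simp
qed

text \<open>The Schur criterion for the test vector with entry 1 at \<open>u\<close> and
  \<open>t\<close> at \<open>u'\<close>, expanded into entries of the Schur matrix. The value
  \<open>t = 0\<close> tests a single vertex.\<close>

lemma two_point_criterion:
  assumes opt: "optimal \<sigma>" and s: "\<bar>s\<bar> = 1" and bal: "\<And>c. 2 * card (cls \<sigma> c) = card V"
    and u: "u \<in> V" "u' \<in> V" "\<sigma> u' = \<sigma> u" and t: "u \<noteq> u' \<or> t = 0"
    and crit: "schur \<sigma> s u u + t\<^sup>2 * schur \<sigma> s u' u' + 2 * t * schur \<sigma> s u u'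
      \<le> sqrt 2 * (1 + t\<^sup>2) - 2 * s * t * of_bool (u' \<in> own \<sigma> u)"
  shows "codim_bound s"
proof (rule schur_criterion[OF opt s bal[of "\<sigma> u"], where u = u
      and y = "\<lambda>v. of_bool (v = u) + t * of_bool (v = u')"
      and w = "\<lambda>v. of_bool (v \<in> cross \<sigma> u) + t * of_bool (v \<in> cross \<sigma> u')"])
  let ?c = "\<sigma> u"
  let ?y = "\<lambda>v. of_bool (v = u) + t * of_bool (v = u') :: real"
  let ?p = "\<lambda>v. of_bool (v \<in> cross \<sigma> u) :: real" and ?q = "\<lambda>v. of_bool (v \<in> cross \<sigma> u') :: real"
  let ?w = "\<lambda>v. ?p v + t * ?q v"
  have cu: "u \<in> cls \<sigma> ?c" "u' \<in> cls \<sigma> ?c" using u by (auto simp: cls_def)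
  show "u \<in> cls \<sigma> ?c" by fact
  show "?y u \<noteq> 0" using t by auto
  have sum_y: "(\<Sum>z \<in> S. ?y z) = of_bool (u \<in> S) + t * of_bool (u' \<in> S)" if "finite S" for S
    using that by (simp add: of_bool_def sum.distrib if_distrib[of "\<lambda>x. t * x"] cong: if_cong)
  show "?w v = (\<Sum>z \<in> cross \<sigma> v. ?y z)" if "v \<in> cls \<sigma> (\<not> ?c)" for v
    using cross_sym[of u \<sigma> v] cross_sym[of u' \<sigma> v] by (simp add: sum_y)
  have sq: "(\<Sum>v \<in> cls \<sigma> ?c. (?y v)\<^sup>2) = 1 + t\<^sup>2"
    unfolding power2_eq_square
    by (subst sum_two_points[OF finite_cls cu]) (use t in \<open>auto simp: power2_eq_square\<close>)
  have "(\<Sum>v \<in> cls \<sigma> ?c. \<Sum>z \<in> own \<sigma> v. ?y v * ?y z) = (\<Sum>v \<in> cls \<sigma> ?c. ?y v * (of_bool (u \<in> own \<sigma> v) + t * of_bool (u' \<in> own \<sigma> v)))"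
    by (simp add: sum_y flip: sum_distrib_left)
  also have "\<dots> = 2 * t * of_bool (u' \<in> own \<sigma> u)"
    by (subst sum_two_points[OF finite_cls cu]) (use own_sym[of u \<sigma> u'] in auto)
  finally have ow: "(\<Sum>v \<in> cls \<sigma> ?c. \<Sum>z \<in> own \<sigma> v. ?y v * ?y z) = 2 * t * of_bool (u' \<in> own \<sigma> u)" .
  define p q where "p v = (of_bool (v \<in> cross \<sigma> u) :: real)" and "q v = (of_bool (v \<in> cross \<sigma> u') :: real)" for v
  \<comment> \<open>The matching is symmetric, so the two mixed terms agree after summation although
    they differ at a single vertex.\<close>
  have swap: "(\<Sum>v \<in> cls \<sigma> (\<not> ?c). \<Sum>z \<in> own \<sigma> v. q v * p z) = (\<Sum>v \<in> cls \<sigma> (\<not> ?c). \<Sum>z \<in> own \<sigma> v. p v * q z)"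
    by (subst sum_own_swap) (simp add: mult.commute)
  have "(\<Sum>v \<in> cls \<sigma> (\<not> ?c). weight \<sigma> v * (p v + t * q v)\<^sup>2 + s * (\<Sum>z \<in> own \<sigma> v. (p v + t * q v) * (p z + t * q z)))
    = (\<Sum>v \<in> cls \<sigma> (\<not> ?c). p v * (weight \<sigma> v * p v + s * (\<Sum>z \<in> own \<sigma> v. p z))
        + t\<^sup>2 * (q v * (weight \<sigma> v * q v + s * (\<Sum>z \<in> own \<sigma> v. q z)))
        + 2 * t * (p v * (weight \<sigma> v * q v + s * (\<Sum>z \<in> own \<sigma> v. q z)))
        + s * t * ((\<Sum>z \<in> own \<sigma> v. q v * p z) - (\<Sum>z \<in> own \<sigma> v. p v * q z)))"
    by (intro sum.cong refl, unfold sum_distrib_left[symmetric] sum.distrib)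
      (simp add: power2_eq_square algebra_simps)
  also have "\<dots> = schur \<sigma> s u u + t\<^sup>2 * schur \<sigma> s u' u' + 2 * t * schur \<sigma> s u u'"
    unfolding sum.distrib schur_alt[OF cu(1)] schur_alt[OF cu(2)] sum_distrib_left[symmetric] sum_subtractf
      p_def[symmetric] q_def[symmetric]
    using swap unfolding sum_distrib_left[symmetric] by simp
  finally show "(\<Sum>v \<in> cls \<sigma> (\<not> ?c). weight \<sigma> v * (?w v)\<^sup>2 + s * (\<Sum>z \<in> own \<sigma> v. ?w v * ?w z))
      \<le> sqrt 2 * (\<Sum>v \<in> cls \<sigma> ?c. (?y v)\<^sup>2) - s * (\<Sum>v \<in> cls \<sigma> ?c. \<Sum>z \<in> own \<sigma> v. ?y v * ?y z)"
    using crit unfolding sq ow p_def q_def by linarith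
qed

section \<open>Upper bound\<close>

lemma weight_le: "weight \<sigma> v \<le> sqrt 2" and weight_pos: "0 < weight \<sigma> v"
  by (auto simp: weight_def)

lemma weight_no_own: "own \<sigma> v = {} \<Longrightarrow> weight \<sigma> v = sqrt 2 / 2"
  by (simp add: weight_def)

lemma sqrt2_bounds: "1 < sqrt 2" "sqrt 2 < 2"
  by (auto intro: real_less_lsqrt)

lemma own_sym_ne: "w \<in> own \<sigma> v \<Longrightarrow> own \<sigma> w \<noteq> {}"
  using own_sym by blast

lemma schur_empty: "cross \<sigma> u = {} \<Longrightarrow> schur \<sigma> s u u' = 0"
  by (simp add: schur_def)

lemma schur_single:
  "cross \<sigma> u = {w} \<Longrightarrow> schur \<sigma> s u u' = of_bool (w \<in> cross \<sigma> u') * weight \<sigma> w + s * card (own \<sigma> w \<inter> cross \<sigma> u')"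
  by (simp add: schur_def)

lemma schur_double:
  "cross \<sigma> u = {w, z} \<Longrightarrow> w \<noteq> z \<Longrightarrow> schur \<sigma> s u u' =
    of_bool (w \<in> cross \<sigma> u') * weight \<sigma> w + s * card (own \<sigma> w \<inter> cross \<sigma> u') +
    (of_bool (z \<in> cross \<sigma> u') * weight \<sigma> z + s * card (own \<sigma> z \<inter> cross \<sigma> u'))"
  by (simp add: schur_def)

lemma card_le_2_cases:
  assumes "finite S" "card S \<le> 2"
  obtains "S = {}" | a where "S = {a}" | a b where "S = {a, b}" "a \<noteq> b"
proof -
  have "card S = 0 \<or> card S = 1 \<or> card S = 2" using assms(2) by linarith
  then show thesis
    using that assms(1) by (auto simp: card_1_singleton_iff card_2_iff)
qed

text \<open>By \<open>one\<close>, the mate of a cross neighbour of \<open>u\<close> is never itself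
  a cross neighbour, so only weights remain. There are at most two, and at most one of them is
  \<open>sqrt 2\<close> rather than \<open>sqrt 2 / 2\<close>.\<close>

lemma schur_diag_le:
  assumes opt: "optimal \<sigma>" and u': "u' \<in> own \<sigma> u"
    and one: "\<And>w1 w2. w1 \<in> cross \<sigma> u \<Longrightarrow> w2 \<in> cross \<sigma> u \<Longrightarrow> own \<sigma> w1 \<noteq> {} \<Longrightarrow> own \<sigma> w2 \<noteq> {} \<Longrightarrow> w1 = w2"
  shows "schur \<sigma> s u u \<le> 3 * sqrt 2 / 2"
proof -
  have "own \<sigma> v \<inter> cross \<sigma> u = {}" if "v \<in> cross \<sigma> u" for v
    using one[OF that] own_sym_ne[of _ \<sigma> v] own_irrefl by blast
  then have "schur \<sigma> s u u = (\<Sum>v \<in> cross \<sigma> u. weight \<sigma> v)"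
    by (simp add: schur_def)
  also have "\<dots> \<le> 3 * sqrt 2 / 2"
    using finite_cross optimal_card_cross[OF opt u']
  proof (cases rule: card_le_2_cases)
    case (3 a b)
    then show ?thesis using one[of a b] by (auto simp: weight_def)
  qed (auto simp: weight_def)
  finally show ?thesis .
qed

lemma schur_nonneg: "schur \<sigma> 1 u u' \<ge> 0"
  unfolding schur_def using weight_pos[of \<sigma>] by (auto intro!: sum_nonneg add_nonneg_nonneg simp: less_imp_le)

text \<open>For the difference of the unit vectors at \<open>w1\<close> and \<open>w2\<close> the
  contribution of the common neighbour \<open>u\<close> cancels. With \<open>a\<close> and
  \<open>b\<close> the possible further cross neighbours of \<open>w1\<close> and \<open>w2\<close>,
  the extra terms for \<open>a = u'\<close> or \<open>b = u'\<close> cancel as well, and at most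
  \<open>weight \<sigma> a + weight \<sigma> b\<close> is left.\<close>

lemma schur_triangle_le:
  assumes opt: "optimal \<sigma>" and w: "w2 \<in> own \<sigma> w1" and u: "u \<in> cross \<sigma> w1" "u \<in> cross \<sigma> w2"
    and u': "u' \<in> own \<sigma> u"
  shows "schur \<sigma> 1 w1 w1 + schur \<sigma> 1 w2 w2 - 2 * schur \<sigma> 1 w1 w2 \<le> 2 * sqrt 2"
proof -
  have w': "w1 \<in> own \<sigma> w2" using w own_sym by blast
  have ou: "own \<sigma> u = {u'}" "own \<sigma> u' = {u}" using optimal_own_eq[OF opt] u' own_sym by blast+
  have uu': "u \<noteq> u'" using u' own_irrefl by blast
  note r = sqrt2_bounds
  have C: "cross \<sigma> w = {u} \<or> (\<exists>a. a \<noteq> u \<and> cross \<sigma> w = {u, a})"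
    if "u \<in> cross \<sigma> w" "card (cross \<sigma> w) \<le> 2" for w
    using finite_cross[of \<sigma> w] that(2) by (cases rule: card_le_2_cases) (use that(1) in auto)
  have own_a: "own \<sigma> a \<inter> {u, a} = (if a = u' then {u} else {})" if "a \<noteq> u" for a
    using that ou own_sym[of u \<sigma> a] by auto
  have Gaa: "schur \<sigma> 1 w w = sqrt 2 + weight \<sigma> a + 2 * of_bool (a = u')"
    if "cross \<sigma> w = {u, a}" "a \<noteq> u" for w a
    using that(2) by (simp add: schur_double[OF that(1)] that(1) own_a ou weight_def)
      (use uu' in auto)
  have G1: "schur \<sigma> 1 w w = sqrt 2" if "cross \<sigma> w = {u}" for w
    using uu' by (simp add: schur_single[OF that] that ou weight_def)
  consider "cross \<sigma> w1 = {u}" | a where "a \<noteq> u" "cross \<sigma> w1 = {u, a}"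
    using C[OF u(1) optimal_card_cross[OF opt w]] by blast
  then show ?thesis
  proof cases
    case 1
    consider "cross \<sigma> w2 = {u}" | b where "b \<noteq> u" "cross \<sigma> w2 = {u, b}"
      using C[OF u(2) optimal_card_cross[OF opt w']] by blast
    then show ?thesis
    proof cases
      case 1
      then show ?thesis using G1 \<open>cross \<sigma> w1 = {u}\<close> uu' r by (simp add: schur_single ou weight_def)
    next
      case (2 b)
      have "schur \<sigma> 1 w1 w2 = sqrt 2 + of_bool (b = u')"
        using uu' 2 by (auto simp: schur_single[OF 1] 2(2) ou weight_def)
      then show ?thesis using G1[OF 1] Gaa[OF 2(2,1)] weight_le[of \<sigma> b] r by linarith
    qed
  next
    case (2 a)
    note a = 2
    consider "cross \<sigma> w2 = {u}" | b where "b \<noteq> u" "cross \<sigma> w2 = {u, b}"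
      using C[OF u(2) optimal_card_cross[OF opt w']] by blast
    then show ?thesis
    proof cases
      case 1
      have "schur \<sigma> 1 w1 w2 = sqrt 2 + of_bool (a = u')"
        using uu' a ou own_sym[of u \<sigma> a] by (auto simp: schur_double[OF a(2)] 1 weight_def)
      then show ?thesis using G1[OF 1] Gaa[OF a(2,1)] weight_le[of \<sigma> a] r by linarith
    next
      case (2 b)
      \<comment> \<open>Equality can fail, as \<open>b\<close> may be the mate of \<open>a\<close>;
        a lower bound suffices because this entry is subtracted.\<close>
      have "card (own \<sigma> a \<inter> {u, b}) \<ge> of_bool (a = u')"
        using ou by (auto simp: of_bool_def card_gt_0_iff Suc_le_eq)
      then have c: "real (card (own \<sigma> a \<inter> {u, b})) \<ge> of_bool (a = u')"
        by (auto simp: of_bool_def)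
      have "card ({u'} \<inter> {u, b}) = of_bool (b = u')" using uu' by auto
      then have "schur \<sigma> 1 w1 w2 \<ge> sqrt 2 + of_bool (b = u') + of_bool (a = u')"
        using c a(1) by (auto simp: schur_double[OF a(2)] 2(2) ou weight_def)
      then show ?thesis using Gaa[OF a(2,1)] Gaa[OF 2(2,1)] weight_le[of \<sigma> a] weight_le[of \<sigma> b] r by linarith
    qed
  qed
qed

section \<open>Consequences of a failing bound, for either sign\<close>

context
  fixes s :: real
  assumes V_ne: "V \<noteq> {}" and s1: "\<bar>s\<bar> = 1" and neg: "\<not> codim_bound s"
begin

lemma balanced: "optimal \<sigma> \<Longrightarrow> 2 * card (cls \<sigma> c) = card V"
  using unbalanced_codim_bound[of \<sigma> s c] unbalanced_codim_bound[of \<sigma> s "\<not> c"] card_cls[of \<sigma> c] s1 neg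
  by linarith

lemma schur_diag_gt:
  assumes "optimal \<sigma>" "u \<in> V"
  shows "schur \<sigma> s u u > sqrt 2"
  using two_point_criterion[OF assms(1) s1 balanced[OF assms(1)] assms(2,2), of 0] neg by fastforce

lemma schur_pair_gt:
  assumes "optimal \<sigma>" "u \<in> V" "u' \<in> V" "\<sigma> u' = \<sigma> u" "u \<noteq> u'" "\<bar>t\<bar> = 1"
  shows "schur \<sigma> s u u + schur \<sigma> s u' u' + 2 * t * schur \<sigma> s u u'
    > 2 * sqrt 2 - 2 * s * t * of_bool (u' \<in> own \<sigma> u)"
proof -
  have "t\<^sup>2 = 1" using assms(6) by (metis power2_abs power_one)
  then show ?thesis
    using two_point_criterion[OF assms(1) s1 balanced[OF assms(1)] assms(2,3,4), of t] assms(5) neg by force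
qed

text \<open>Without monochromatic edges, Schur entries are \<open>sqrt 2 / 2\<close> times numbers
  of common neighbours. The diagonal bound forces degree three, and two neighbours \<open>a\<close>,
  \<open>b\<close> of one vertex, tested with opposite signs, give at most
  \<open>sqrt 2 / 2 * (3 + 3 - 2) = 2 * sqrt 2\<close>.\<close>

lemma exists_own:
  assumes opt: "optimal \<sigma>"
  obtains u u' where "u' \<in> own \<sigma> u"
proof (rule ccontr)
  assume "\<not> thesis"
  then have none: "own \<sigma> v = {}" for v using that by blast
  have G: "schur \<sigma> s u u' = sqrt 2 / 2 * card (cross \<sigma> u \<inter> cross \<sigma> u')" for u u'
  proof -
    have "schur \<sigma> s u u' = (\<Sum>v \<in> cross \<sigma> u. of_bool (v \<in> cross \<sigma> u') * weight \<sigma> v)"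
      by (simp add: schur_def none)
    also have "\<dots> = (\<Sum>v \<in> cross \<sigma> u \<inter> cross \<sigma> u'. weight \<sigma> v)"
      by (rule sum_of_bool_mult) simp
    finally show ?thesis by (simp add: weight_def none)
  qed
  obtain v where "v \<in> V" using V_ne by blast
  then have "card (cross \<sigma> v) > 2"
    using schur_diag_gt[OF opt, of v] by (simp add: G)
  then obtain a b where ab: "a \<in> cross \<sigma> v" "b \<in> cross \<sigma> v" "a \<noteq> b"
    using card_le_Suc0_iff_eq[OF finite_cross, of \<sigma> v] by force
  then have V: "a \<in> V" "b \<in> V" "\<sigma> b = \<sigma> a" using in_V by (auto simp: cross_def)
  have "v \<in> cross \<sigma> a \<inter> cross \<sigma> b" using ab cross_sym by blast
  then have "card (cross \<sigma> a \<inter> cross \<sigma> b) \<ge> 1"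
    by (metis One_nat_def Suc_leI card_gt_0_iff empty_iff finite_Int finite_cross)
  moreover have "card (cross \<sigma> a) \<le> 3" "card (cross \<sigma> b) \<le> 3"
    using card_own_cross[of \<sigma> a] card_nbrs_le[of a] card_own_cross[of \<sigma> b] card_nbrs_le[of b] by linarith+
  ultimately have "real (card (cross \<sigma> a)) + real (card (cross \<sigma> b)) - 2 * real (card (cross \<sigma> a \<inter> cross \<sigma> b)) \<le> 4"
    by linarith
  then have "sqrt 2 / 2 * (real (card (cross \<sigma> a)) + real (card (cross \<sigma> b)) - 2 * real (card (cross \<sigma> a \<inter> cross \<sigma> b)))
      \<le> sqrt 2 / 2 * 4"
    by (intro mult_left_mono) auto
  moreover have "schur \<sigma> s a a + schur \<sigma> s b b + 2 * (-1) * schur \<sigma> s a b > 2 * sqrt 2"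
    using schur_pair_gt[OF opt V ab(3), of "-1"] none by simp
  ultimately show False by (simp add: G algebra_simps)
qed

end

text \<open>A monochromatic edge is tested with opposite signs at its ends, where failure needs more
  than \<open>2 * sqrt 2 + 2\<close>. If no end has two matched cross neighbours, the diagonal
  entries give only \<open>3 * sqrt 2\<close>. Two such neighbours would themselves be joined by a
  monochromatic edge, and the triangle estimate refutes failure there.\<close>

theorem codim_bound_pos:
  assumes "V \<noteq> {}"
  shows "codim_bound 1"
proof (rule ccontr)
  assume neg: "\<not> codim_bound 1"
  note ctx = assms abs_one neg
  obtain \<sigma> where opt: "optimal \<sigma>" using exists_optimal by blast
  obtain u u' where u': "u' \<in> own \<sigma> u" using exists_own[OF ctx opt] by blast
  have u: "u \<in> own \<sigma> u'" using u' own_sym by blast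
  have no_two: "w1 = w2"
    if v: "v' \<in> own \<sigma> v" and w: "w1 \<in> cross \<sigma> v" "w2 \<in> cross \<sigma> v" "own \<sigma> w1 \<noteq> {}" "own \<sigma> w2 \<noteq> {}"
    for v v' w1 w2
  proof (rule ccontr)
    assume ne: "w1 \<noteq> w2"
    then have w2: "w2 \<in> own \<sigma> w1" using optimal_cross_adjacent[OF opt v w(1,2) _ w(3,4)] by blast
    then have "w1 \<in> V" "w2 \<in> V" "\<sigma> w2 = \<sigma> w1" using in_V by (auto simp: own_def)
    then have "schur \<sigma> 1 w1 w1 + schur \<sigma> 1 w2 w2 + 2 * (-1) * schur \<sigma> 1 w1 w2 > 2 * sqrt 2 + 2"
      using schur_pair_gt[OF ctx opt _ _ _ ne, of "-1"] w2 by simp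
    moreover have "schur \<sigma> 1 w1 w1 + schur \<sigma> 1 w2 w2 - 2 * schur \<sigma> 1 w1 w2 \<le> 2 * sqrt 2"
      using schur_triangle_le[OF opt w2 _ _ v] w cross_sym by blast
    ultimately show False by simp
  qed
  have uV: "u \<in> V" "u' \<in> V" "\<sigma> u' = \<sigma> u" using u' in_V by (auto simp: own_def)
  have ne: "u \<noteq> u'" using u' own_irrefl by blast
  have "schur \<sigma> 1 u u \<le> 3 * sqrt 2 / 2" "schur \<sigma> 1 u' u' \<le> 3 * sqrt 2 / 2"
    using schur_diag_le[OF opt u' no_two[OF u']] schur_diag_le[OF opt u no_two[OF u]] by blast+
  moreover have "schur \<sigma> 1 u u + schur \<sigma> 1 u' u' + 2 * (-1) * schur \<sigma> 1 u u' > 2 * sqrt 2 + 2"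
    using schur_pair_gt[OF ctx opt uV ne, of "-1"] u' by simp
  ultimately show False using schur_nonneg[of \<sigma> u u'] sqrt2_bounds by simp
qed

section \<open>Lower bound\<close>

context
  assumes V_ne: "V \<noteq> {}" and neg: "\<not> codim_bound (- 1)"
begin

text \<open>The diagonal entry must exceed \<open>sqrt 2\<close>. Fewer than two cross neighbours or
  two unmatched ones give at most \<open>sqrt 2\<close>; two matched ones are mates of each other,
  and their off-diagonal terms lower the entry to \<open>2 * sqrt 2 - 2\<close>.\<close>

lemma own_cross_structure:
  assumes opt: "optimal \<sigma>" and u: "u' \<in> own \<sigma> u"
  obtains w z where "cross \<sigma> u = {w, z}" "own \<sigma> w \<noteq> {}" "own \<sigma> z = {}"
proof -
  have "u \<in> V" using u in_V by (auto simp: own_def)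
  then have gt: "schur \<sigma> (- 1) u u > sqrt 2"
    using schur_diag_gt[OF V_ne _ neg opt] by simp
  note r = sqrt2_bounds
  from finite_cross optimal_card_cross[OF opt u] show thesis
  proof (cases rule: card_le_2_cases)
    case 1
    then show ?thesis using gt by (simp add: schur_empty)
  next
    case (2 a)
    then show ?thesis using gt weight_le[of \<sigma> a] by (simp add: schur_single)
  next
    case (3 a b)
    have G: "schur \<sigma> (- 1) u u \<le> weight \<sigma> a + weight \<sigma> b"
      by (simp add: schur_double[OF 3] 3(1))
    consider "own \<sigma> a = {}" "own \<sigma> b = {}" | "own \<sigma> a \<noteq> {}" "own \<sigma> b \<noteq> {}"
      | "own \<sigma> a \<noteq> {}" "own \<sigma> b = {}" | "own \<sigma> a = {}" "own \<sigma> b \<noteq> {}" by blast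
    then show ?thesis
    proof cases
      case 1
      then show ?thesis using G gt by (simp add: weight_def)
    next
      case 2
      have b: "b \<in> own \<sigma> a"
        using optimal_cross_adjacent[OF opt u] 3 2 by blast
      then have "own \<sigma> a = {b}" "own \<sigma> b = {a}" using optimal_own_eq[OF opt] own_sym by blast+
      then have "schur \<sigma> (- 1) u u = 2 * sqrt 2 - 2"
        by (simp add: schur_double[OF 3] 3(1) weight_def)
      then show ?thesis using gt r by simp
    next
      case 3
      then show ?thesis using that \<open>cross \<sigma> u = {a, b}\<close> by blast
    next
      case 4
      then show ?thesis using that[of b a] \<open>cross \<sigma> u = {a, b}\<close> by blast
    qed
  qed
qed

lemma own_cross_unique:
  assumes opt: "optimal \<sigma>" and u: "own \<sigma> u \<noteq> {}"
    and w: "w1 \<in> cross \<sigma> u" "w2 \<in> cross \<sigma> u" "own \<sigma> w1 = {} \<longleftrightarrow> own \<sigma> w2 = {}"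
  shows "w1 = w2"
proof -
  obtain u' where "u' \<in> own \<sigma> u" using u by blast
  then obtain w z where "cross \<sigma> u = {w, z}" "own \<sigma> w \<noteq> {}" "own \<sigma> z = {}"
    using own_cross_structure[OF opt] by metis
  then show ?thesis using w by auto
qed

text \<open>The end vertices of a monochromatic edge have a common neighbour, its apex \<open>z\<close>.\<close>

lemma own_edge_structure:
  assumes opt: "optimal \<sigma>" and u: "u' \<in> own \<sigma> u"
  obtains w w' z where "cross \<sigma> u = {w, z}" "cross \<sigma> u' = {w', z}"
    "own \<sigma> w \<noteq> {}" "own \<sigma> w' \<noteq> {}" "own \<sigma> z = {}" "w \<noteq> w'" "w' \<notin> own \<sigma> w"
proof -
  note r = sqrt2_bounds
  have u': "u \<in> own \<sigma> u'" using u own_sym by blast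
  have ne: "u \<noteq> u'" using u own_irrefl by blast
  have uV: "u \<in> V" "u' \<in> V" "\<sigma> u' = \<sigma> u" using u in_V by (auto simp: own_def)
  obtain w z where c: "cross \<sigma> u = {w, z}" "own \<sigma> w \<noteq> {}" "own \<sigma> z = {}"
    using own_cross_structure[OF opt u] .
  obtain w' z' where c': "cross \<sigma> u' = {w', z'}" "own \<sigma> w' \<noteq> {}" "own \<sigma> z' = {}"
    using own_cross_structure[OF opt u'] .
  \<comment> \<open>A common matched neighbour would have both \<open>u\<close> and
    \<open>u'\<close> as matched cross neighbours, but it can have only one.\<close>
  have ww: "w \<noteq> w'"
  proof
    assume "w = w'"
    then have "u \<in> cross \<sigma> w" "u' \<in> cross \<sigma> w" using c(1) c'(1) cross_sym by blast+
    then show False using own_cross_unique[OF opt c(2), of u u'] u u' ne by blast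
  qed
  have wz: "w \<noteq> z" "w \<noteq> z'" "w' \<noteq> z" using c c' by metis+
  have "schur \<sigma> (- 1) u u \<le> 3 * sqrt 2 / 2" "schur \<sigma> (- 1) u' u' \<le> 3 * sqrt 2 / 2"
    using schur_diag_le[OF opt u, of "- 1"] schur_diag_le[OF opt u', of "- 1"] c c' by auto
  moreover have "z' \<notin> own \<sigma> w" using own_sym_ne c'(3) by blast
  then have "own \<sigma> w \<inter> {w', z'} = (if w' \<in> own \<sigma> w then {w'} else {})" by auto
  then have "schur \<sigma> (- 1) u u' = of_bool (z = z') * (sqrt 2 / 2) - of_bool (w' \<in> own \<sigma> w)"
    using ww wz c(3) by (simp add: schur_double[OF c(1) wz(1)] c'(1) weight_no_own)
  moreover have "schur \<sigma> (- 1) u u + schur \<sigma> (- 1) u' u' + 2 * 1 * schur \<sigma> (- 1) u u' > 2 * sqrt 2 + 2"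
    using schur_pair_gt[OF V_ne _ neg opt uV ne, of 1] u by simp
  \<comment> \<open>The diagonal entries contribute at most \<open>3 * sqrt 2\<close>, so the
    off-diagonal entry must supply the rest. The right-hand side is positive, while
    \<open>sqrt 2 - 2\<close> is negative, so only one combination of truth values survives.\<close>
  ultimately have "of_bool (z = z') * sqrt 2 - 2 * of_bool (w' \<in> own \<sigma> w) > 2 - sqrt 2"
    by linarith
  then have "z = z'" "w' \<notin> own \<sigma> w" using r by (auto simp: of_bool_def split: if_splits)
  then show thesis using that[of w z w'] c c' ww by blast
qed

text \<open>Exchanging the colours of \<open>u\<close> and \<open>w\<close> turns \<open>uz\<close> into a monochromatic edge of another
  optimal colouring, whose apex is \<open>u'\<close>.\<close>

lemma apex_adjacent:
  assumes opt: "optimal \<sigma>" and u: "u' \<in> own \<sigma> u"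
    and c: "cross \<sigma> u = {w, z}" "own \<sigma> w \<noteq> {}" "own \<sigma> z = {}"
  obtains r where "r \<in> cross \<sigma> w" "own \<sigma> r = {}" "r \<in> nbrs z"
proof -
  obtain w' where w': "w' \<in> own \<sigma> w" using c by blast
  have wc: "w \<in> cross \<sigma> u" using c by blast
  have wz: "w \<noteq> z" using c by blast
  have uw: "u \<in> cross \<sigma> w" using wc cross_sym by blast
  obtain p r where pr: "cross \<sigma> w = {p, r}" "own \<sigma> p \<noteq> {}" "own \<sigma> r = {}"
    using own_cross_structure[OF opt w'] .
  \<comment> \<open>\<open>u\<close> is matched and lies across from \<open>w\<close>, so it is the
    matched one of the two cross neighbours of \<open>w\<close>.\<close>
  have "u = p" using uw pr u by auto
  note pr = pr[folded this]
  have ur: "u \<noteq> r" using pr by blast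
  have col: "\<sigma> w \<noteq> \<sigma> u" "\<sigma> z \<noteq> \<sigma> u" "\<sigma> r = \<sigma> u" "\<sigma> u' = \<sigma> u"
    using c(1) pr(1) u by (auto simp: cross_def own_def)
  have Nu: "nbrs u = {u', w, z}"
    unfolding nbrs_own_cross[of u \<sigma>] optimal_own_eq[OF opt u] c(1) by blast
  have adj: "z \<in> nbrs u" "w \<in> nbrs u" "u' \<in> nbrs u" "r \<in> nbrs w" "u \<in> nbrs w"
    using c(1) u pr(1) uw by (auto simp: own_def cross_def)
  have zu: "z \<noteq> u" "w \<noteq> u" "u' \<noteq> u" using col adj nbrs_irrefl by metis+
  have u'w: "u' \<noteq> w" "u' \<noteq> z" using col by auto
  define \<tau> where "\<tau> = flip w (flip u \<sigma>)"
  have optt: "optimal \<tau>" unfolding \<tau>_def by (rule optimal_swap[OF opt u wc w'])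
  have \<tau>: "\<tau> x = (if x = u \<or> x = w then \<not> \<sigma> x else \<sigma> x)" for x
    using zu by (auto simp: \<tau>_def flip_def)
  \<comment> \<open>The edge structure is now applied to \<open>u z\<close> under
    \<open>\<tau>\<close>. There \<open>w\<close> is matched, with mate \<open>r\<close>, so
    \<open>u'\<close> must be the apex, and \<open>p'\<close> is the matched cross neighbour of
    \<open>z\<close>.\<close>
  have "z \<in> own \<tau> u" using adj col zu wz by (auto simp: own_def \<tau>)
  then obtain p p' q where st: "cross \<tau> u = {p, q}" "cross \<tau> z = {p', q}"
    "own \<tau> p \<noteq> {}" "own \<tau> p' \<noteq> {}" "own \<tau> q = {}" "p \<noteq> p'"
    by (rule own_edge_structure[OF optt]) blast
  have "w \<in> cross \<tau> u" "u' \<in> cross \<tau> u" using adj col zu u'w by (auto simp: cross_def \<tau>)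
  moreover have "r \<in> own \<tau> w" using adj col ur nbrs_irrefl[of w] by (auto simp: own_def \<tau>)
  ultimately have pq: "p = w" "q = u'" using st u'w by auto
  have p'z: "p' \<in> nbrs z" "u' \<in> nbrs z" "\<tau> p' \<noteq> \<tau> z" using st(2) pq by (auto simp: cross_def)
  have p'ne: "p' \<noteq> w" "p' \<noteq> u'" "p' \<noteq> u" "p' \<noteq> z"
    using st pq p'z nbrs_irrefl[of z] col zu wz by (auto simp: \<tau>)
  have p'col: "\<sigma> p' \<noteq> \<sigma> z" using p'z(3) p'ne wz zu by (simp add: \<tau>)
  have p'u: "p' \<notin> nbrs u" using Nu p'ne by blast
  \<comment> \<open>If \<open>p'\<close> had a mate under \<open>\<sigma>\<close>, the apex of that
    edge would be the unmatched \<open>z\<close>, giving \<open>z\<close> the four neighbours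
    \<open>u\<close>, \<open>u'\<close>, \<open>p'\<close> and the mate.\<close>
  have "own \<sigma> p' = {}"
  proof (rule ccontr)
    assume "own \<sigma> p' \<noteq> {}"
    then obtain p'' where p'': "p'' \<in> own \<sigma> p'" by blast
    obtain w1 w2 y where y: "cross \<sigma> p' = {w1, y}" "cross \<sigma> p'' = {w2, y}"
      "own \<sigma> w1 \<noteq> {}" "own \<sigma> w2 \<noteq> {}" "own \<sigma> y = {}"
      by (rule own_edge_structure[OF opt p'']) blast
    have "z \<in> cross \<sigma> p'" using p'z(1) p'col nbrs_sym[of z p'] by (simp add: cross_def)
    then have "z = y" using y c(3) by auto
    then have "p'' \<in> nbrs z" using y(2) nbrs_sym[of z p''] by (auto simp: cross_def)
    moreover have "p'' \<noteq> u"
      using p'' p'u nbrs_sym[of u p'] by (auto simp: own_def)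
    moreover have "p'' \<noteq> u'"
      using p'' p'ne u optimal_own_unique[OF opt, of u u' p'] own_sym by blast
    moreover have "p'' \<noteq> p'" using p'' own_irrefl by blast
    moreover have "u \<in> nbrs z" using adj nbrs_sym by blast
    ultimately show False
      using card_3_contradiction[of u z u' p' p''] p'z p'ne zu by auto
  qed
  \<comment> \<open>\<open>p'\<close> has a mate under \<open>\<tau>\<close> but none under
    \<open>\<sigma>\<close>, so the mate is a recoloured vertex. It is not \<open>u\<close>, whose
    neighbours are known; hence it is \<open>w\<close>, and \<open>p'\<close> is the remaining cross
    neighbour \<open>r\<close> of \<open>w\<close>.\<close>
  moreover obtain x where x: "x \<in> own \<tau> p'" using st by blast
  ultimately have "x = u \<or> x = w"
    using p'ne by (auto simp: own_def \<tau> split: if_splits)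
  then have "x = w" using x p'u nbrs_sym[of u p'] by (auto simp: own_def)
  then have "p' \<in> cross \<sigma> w" using x p'ne nbrs_sym[of w p'] by (auto simp: own_def cross_def \<tau>)
  then have "p' = r" using pr(1) p'ne by blast
  then show thesis using that[of r] pr p'z by blast
qed

text \<open>Both ends of a monochromatic edge yield a further neighbour of the apex
  \<open>z\<close>, and the degree of \<open>z\<close> forces these to coincide in one vertex
  \<open>r\<close>. Then \<open>r\<close> is adjacent to \<open>z\<close>, \<open>w\<close>,
  \<open>w'\<close> and the mate of \<open>w\<close>, which are four vertices.\<close>

lemma codim_bound_neg_contradiction: False
proof -
  obtain \<sigma> where opt: "optimal \<sigma>" using exists_optimal by blast
  obtain u u' where u: "u' \<in> own \<sigma> u"
    using exists_own[OF V_ne _ neg opt] by (metis abs_minus abs_one)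
  have u': "u \<in> own \<sigma> u'" using u own_sym by blast
  obtain w w' z where st: "cross \<sigma> u = {w, z}" "cross \<sigma> u' = {w', z}"
    "own \<sigma> w \<noteq> {}" "own \<sigma> w' \<noteq> {}" "own \<sigma> z = {}" "w \<noteq> w'" "w' \<notin> own \<sigma> w"
    by (rule own_edge_structure[OF opt u])
  obtain r where r: "r \<in> cross \<sigma> w" "own \<sigma> r = {}" "r \<in> nbrs z"
    by (rule apex_adjacent[OF opt u st(1,3,5)])
  obtain r' where r': "r' \<in> cross \<sigma> w'" "own \<sigma> r' = {}" "r' \<in> nbrs z"
    by (rule apex_adjacent[OF opt u' st(2,4,5)])
  have z: "u \<in> nbrs z" "u' \<in> nbrs z"
    using st(1,2) nbrs_sym[of z] by (auto simp: cross_def)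
  have rr: "r = r'"
  proof (rule ccontr)
    assume "r \<noteq> r'"
    moreover have "u \<noteq> u'" using u own_irrefl by blast
    moreover have "r \<noteq> u" "r \<noteq> u'" "r' \<noteq> u" "r' \<noteq> u'" using r r' u u' by auto
    ultimately show False using card_3_contradiction[OF z r(3) r'(3)] by auto
  qed
  \<comment> \<open>An unmatched cross neighbour of a matched vertex is the apex of its
    monochromatic edge, hence also adjacent to the mate.\<close>
  have mate: "\<exists>m. m \<in> own \<sigma> x \<and> r \<in> cross \<sigma> m" if x: "own \<sigma> x \<noteq> {}" "r \<in> cross \<sigma> x" for x
  proof -
    obtain m where m: "m \<in> own \<sigma> x" using x by blast
    obtain a a' q where q: "cross \<sigma> x = {a, q}" "cross \<sigma> m = {a', q}" "own \<sigma> a \<noteq> {}" "own \<sigma> q = {}"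
      by (rule own_edge_structure[OF opt m]) blast
    then have "r = q" using x r by auto
    then show ?thesis using m q by blast
  qed
  obtain m where m: "m \<in> own \<sigma> w" "r \<in> cross \<sigma> m" using mate[OF st(3) r(1)] by blast
  have "m \<noteq> w" "m \<noteq> w'" using m st(7) own_irrefl by blast+
  moreover have "z \<noteq> w" "z \<noteq> w'" "z \<noteq> m" using st m own_sym_ne by metis+
  moreover have "w \<in> nbrs r" "w' \<in> nbrs r" "m \<in> nbrs r" "z \<in> nbrs r"
    using r r' rr m nbrs_sym by (auto simp: cross_def)
  ultimately show False using card_3_contradiction[of w r w' m z] st(6) by auto
qed

end

theorem codim_bound_neg: "V \<noteq> {} \<Longrightarrow> codim_bound (- 1)"
  using codim_bound_neg_contradiction by blast

end

section \<open>Median eigenvalues\<close>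

lemma out_degree_card: "out_degree (with_proj G) u = card {v. (u, v) \<in> parcs G}"
proof -
  have "out_arcs (with_proj G) u = Pair u ` {v. (u, v) \<in> parcs G}"
    by (auto simp: out_arcs_def)
  then show ?thesis by (simp add: out_degree_def card_image inj_on_def)
qed

lemma subcubic_graphI:
  assumes G: "pair_graph G" and sub: "subcubic G"
  shows "subcubic_graph (pverts G) (parcs G)"
proof -
  interpret pair_graph G by (fact G)
  show ?thesis
  proof
    show "finite (pverts G)" by simp
    show "parcs G \<subseteq> pverts G \<times> pverts G" using in_arcsD1 in_arcsD2 by auto
    show "(v, u) \<in> parcs G" if "(u, v) \<in> parcs G" for u v using that by (rule arcs_symmetric)
    show "(v, v) \<notin> parcs G" for v using pair_no_loops[of "(v, v)"] by auto
    show "card {w. (v, w) \<in> parcs G} \<le> 3" if "v \<in> pverts G" for v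
    proof -
      have "out_degree (with_proj G) v \<le> max_degree G"
        unfolding max_degree_def using that by (intro Max_ge) auto
      then show ?thesis using sub by (simp add: subcubic_def out_degree_card)
    qed
  qed
qed

text \<open>The counts bound the first median from above and the second from below. As the list is
  non-increasing, the second is at most the first, so both lie in the interval.\<close>

theorem median_eigenvalues_bounds:
  assumes G: "pair_graph G" and ne: "pverts G \<noteq> {}" and sub: "subcubic G"
  shows "eigval G (H_index G) \<in> {- sqrt 2..sqrt 2}" "eigval G (L_index G) \<in> {- sqrt 2..sqrt 2}"
proof -
  interpret pair_graph G by (fact G)
  interpret S: subcubic_graph "pverts G" "parcs G" by (rule subcubic_graphI[OF G sub])
  let ?M = "proots (char_poly (adjacency_mat G))" and ?n = "order_of G"
  let ?L = "rev (sorted_list_of_multiset ?M)" and ?k = "(order_of G - 1) div 2"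
  have size: "size ?M = ?n" by (rule size_eigenvalues[OF G])
  have n: "?n > 0" using ne by (simp add: order_of_def card_gt_0_iff)
  have "S.form = adj_form G" by (simp add: fun_eq_iff S.form_def S.nbrs_def adj_form_def)
  have count: "size (filter_mset (\<lambda>e. s * e > sqrt 2) ?M) \<le> ?k" if s: "S.codim_bound s" for s
  proof -
    obtain F where F: "length F \<le> ?k" and "\<forall>x. (\<forall>f \<in> set F. (\<Sum>v \<in> pverts G. f v * x v) = 0)
        \<longrightarrow> s * adj_form G x \<le> sqrt 2 * (\<Sum>v \<in> pverts G. (x v)\<^sup>2)"
      using s unfolding S.codim_bound_def \<open>S.form = adj_form G\<close> order_of_def by blast
    then have "size (filter_mset (\<lambda>e. s * e > sqrt 2) ?M) \<le> length F"
      by (intro count_adjacency_eigenvalues_le[OF G]) blast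
    then show ?thesis using F by linarith
  qed
  have H: "eigval G (H_index G) = ?L ! ?k" and L: "eigval G (L_index G) = ?L ! (?n - 1 - ?k)"
    using H_index_minus_1[OF G ne] L_index_minus_1[OF G ne] by (simp_all add: eigval_def eigenvalue_list_def)
  have "?L ! ?k \<le> sqrt 2"
    by (rule rev_sorted_list_of_multiset_le) (use count[OF S.codim_bound_pos[OF ne]] n size in auto)
  moreover have "?L ! (?n - 1 - ?k) \<ge> - sqrt 2"
  proof -
    have "size (filter_mset (\<lambda>e. e < - sqrt 2) ?M) \<le> ?k"
      using count[OF S.codim_bound_neg[OF ne]] by (simp add: minus_less_iff less_minus_iff)
    then show ?thesis
      using rev_sorted_list_of_multiset_ge[of "- sqrt 2" ?M ?k] n size by simp
  qed
  moreover have "?L ! (?n - 1 - ?k) \<le> ?L ! ?k"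
  proof -
    have len: "length ?L = ?n" by (metis length_rev mset_sorted_list_of_multiset size size_mset)
    have "?k \<le> ?n - 1 - ?k" "?n - 1 - ?k < length ?L" using n unfolding len by linarith+
    then show ?thesis by (intro sorted_rev_nth_mono) simp_all
  qed
  ultimately show "eigval G (H_index G) \<in> {- sqrt 2..sqrt 2}" "eigval G (L_index G) \<in> {- sqrt 2..sqrt 2}"
    unfolding H L by auto
qed

section \<open>The Heawood graph\<close>

text \<open>Points \<open>0, \<dots>, 6\<close> and lines \<open>7, \<dots>, 13\<close> of the Fano plane: the point \<open>i\<close> lies on the lines
  \<open>7 + (i + d) mod 7\<close> for \<open>d\<close> in the perfect difference set \<open>{0, 1, 3}\<close>.\<close>

definition heawood_edges :: "(nat \<times> nat) list" where
  "heawood_edges =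
    [(0, 7), (0, 8), (0, 10), (1, 8), (1, 9), (1, 11), (2, 9), (2, 10), (2, 12), (3, 10), (3, 11), (3, 13),
     (4, 11), (4, 12), (4, 7), (5, 12), (5, 13), (5, 8), (6, 13), (6, 7), (6, 9)]"

definition heawood :: "nat pair_pre_digraph" where
  "heawood = \<lparr>pverts = {..<14}, parcs = set heawood_edges \<union> (set heawood_edges)\<inverse>\<rparr>"

lemma pverts_heawood: "pverts heawood = {..<14}"
  by (simp add: heawood_def)

lemma pverts_heawood_ne: "pverts heawood \<noteq> {}"
  unfolding pverts_heawood lessThan_empty_iff by simp

lemma pair_graph_heawood: "pair_graph heawood"
proof
  show "symmetric (with_proj heawood)"
    by (auto simp: symmetric_def heawood_def intro!: symI)
qed (auto simp: heawood_def heawood_edges_def)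

lemma all_less_14:
  "(\<forall>u < 14. P u) \<longleftrightarrow> P 0 \<and> P 1 \<and> P 2 \<and> P 3 \<and> P 4 \<and> P 5 \<and> P 6 \<and> P 7 \<and> P 8 \<and> P 9 \<and> P 10 \<and> P 11 \<and> P 12 \<and> P (13 :: nat)"
  by (simp add: numeral_eq_Suc All_less_Suc conj_ac)

lemma heawood_nbrs:
  "{v. (0, v) \<in> parcs heawood} = {7, 8, 10}" "{v. (1, v) \<in> parcs heawood} = {8, 9, 11}"
  "{v. (2, v) \<in> parcs heawood} = {9, 10, 12}" "{v. (3, v) \<in> parcs heawood} = {10, 11, 13}"
  "{v. (4, v) \<in> parcs heawood} = {11, 12, 7}" "{v. (5, v) \<in> parcs heawood} = {12, 13, 8}"
  "{v. (6, v) \<in> parcs heawood} = {13, 7, 9}" "{v. (7, v) \<in> parcs heawood} = {0, 4, 6}"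
  "{v. (8, v) \<in> parcs heawood} = {0, 1, 5}" "{v. (9, v) \<in> parcs heawood} = {1, 2, 6}"
  "{v. (10, v) \<in> parcs heawood} = {0, 2, 3}" "{v. (11, v) \<in> parcs heawood} = {1, 3, 4}"
  "{v. (12, v) \<in> parcs heawood} = {2, 4, 5}" "{v. (13, v) \<in> parcs heawood} = {3, 5, 6}"
  by (simp_all add: heawood_def heawood_edges_def) auto

lemma max_degree_heawood: "max_degree heawood = 3"
proof -
  have "\<forall>u < 14. out_degree (with_proj heawood) u = 3"
    unfolding all_less_14 out_degree_card heawood_nbrs by simp
  then have "out_degree (with_proj heawood) ` pverts heawood = {3}"
    by (auto simp: pverts_heawood intro!: image_eqI[of _ _ 0])
  then show ?thesis by (simp add: max_degree_def)
qed

text \<open>This is \<open>N N\<^sup>T = 2 I + J\<close> as an identity of quadratic forms: every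
  point lies on three lines, and any two points on exactly one.\<close>

lemma fano_identity:
  fixes a b c d e f g :: real
  shows "(a + e + g)\<^sup>2 + (a + b + f)\<^sup>2 + (b + c + g)\<^sup>2 + (a + c + d)\<^sup>2 + (b + d + e)\<^sup>2 + (c + e + f)\<^sup>2 + (d + f + g)\<^sup>2
    = 2 * (a\<^sup>2 + b\<^sup>2 + c\<^sup>2 + d\<^sup>2 + e\<^sup>2 + f\<^sup>2 + g\<^sup>2) + (a + b + c + d + e + f + g)\<^sup>2"
  by (simp add: power2_eq_square algebra_simps)

text \<open>The eigenvalue equation turns sums over lines into multiples of the entries, so the Fano
  identity bounds the squared norm \<open>?P\<close> on points by that on lines, \<open>?Q\<close>,
  and dually. Adding both gives \<open>2 * (?P + ?Q) \<le> e\<^sup>2 * (?P + ?Q)\<close>.\<close>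

lemma heawood_eigenvalues:
  assumes "e \<in># proots (char_poly (adjacency_mat heawood))"
  shows "\<bar>e\<bar> \<ge> sqrt 2"
proof -
  obtain x where x0: "\<exists>v \<in> pverts heawood. x v \<noteq> 0"
    and ev: "\<And>u. u \<in> pverts heawood \<Longrightarrow> (\<Sum>v | (u, v) \<in> parcs heawood. x v) = e * x u"
    using adjacency_eigenvector[OF pair_graph_heawood assms] by blast
  let ?P = "(x 0)\<^sup>2 + (x 1)\<^sup>2 + (x 2)\<^sup>2 + (x 3)\<^sup>2 + (x 4)\<^sup>2 + (x 5)\<^sup>2 + (x 6)\<^sup>2"
  let ?Q = "(x 7)\<^sup>2 + (x 8)\<^sup>2 + (x 9)\<^sup>2 + (x 10)\<^sup>2 + (x 11)\<^sup>2 + (x 12)\<^sup>2 + (x 13)\<^sup>2"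
  have "\<forall>u < 14. (\<Sum>v | (u, v) \<in> parcs heawood. x v) = e * x u"
    using ev by (simp add: pverts_heawood)
  then have ev': "e * x 0 = x 7 + x 8 + x 10" "e * x 1 = x 8 + x 9 + x 11" "e * x 2 = x 9 + x 10 + x 12"
    "e * x 3 = x 10 + x 11 + x 13" "e * x 4 = x 7 + x 11 + x 12" "e * x 5 = x 8 + x 12 + x 13"
    "e * x 6 = x 7 + x 9 + x 13" "e * x 7 = x 0 + x 4 + x 6" "e * x 8 = x 0 + x 1 + x 5"
    "e * x 9 = x 1 + x 2 + x 6" "e * x 10 = x 0 + x 2 + x 3" "e * x 11 = x 1 + x 3 + x 4"
    "e * x 12 = x 2 + x 4 + x 5" "e * x 13 = x 3 + x 5 + x 6"
    unfolding all_less_14 heawood_nbrs by simp_all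
  have "e\<^sup>2 * ?Q = (x 0 + x 4 + x 6)\<^sup>2 + (x 0 + x 1 + x 5)\<^sup>2 + (x 1 + x 2 + x 6)\<^sup>2 + (x 0 + x 2 + x 3)\<^sup>2
      + (x 1 + x 3 + x 4)\<^sup>2 + (x 2 + x 4 + x 5)\<^sup>2 + (x 3 + x 5 + x 6)\<^sup>2"
    unfolding ev'[symmetric] by (simp add: power_mult_distrib distrib_left)
  then have 1: "e\<^sup>2 * ?Q \<ge> 2 * ?P"
    unfolding fano_identity by simp
  have "e\<^sup>2 * ?P = (x 7 + x 8 + x 10)\<^sup>2 + (x 8 + x 9 + x 11)\<^sup>2 + (x 9 + x 10 + x 12)\<^sup>2 + (x 10 + x 11 + x 13)\<^sup>2
      + (x 7 + x 11 + x 12)\<^sup>2 + (x 8 + x 12 + x 13)\<^sup>2 + (x 7 + x 9 + x 13)\<^sup>2"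
    unfolding ev'[symmetric] by (simp add: power_mult_distrib distrib_left)
  also have "\<dots> = 2 * ?Q + (x 7 + x 8 + x 9 + x 10 + x 11 + x 12 + x 13)\<^sup>2"
    by (simp add: power2_eq_square algebra_simps)
  finally have 2: "e\<^sup>2 * ?P \<ge> 2 * ?Q" by simp
  have "?P + ?Q > 0"
  proof (rule ccontr)
    assume "\<not> ?P + ?Q > 0"
    then have "?P + ?Q = 0" by (smt (verit) zero_le_power2)
    then have "\<forall>u < 14. x u = 0"
      unfolding all_less_14 by (smt (verit) zero_le_power2 power2_eq_iff zero_power2 zero_eq_power2)
    with x0 show False by (auto simp: pverts_heawood)
  qed
  moreover have "2 * (?P + ?Q) \<le> e\<^sup>2 * (?P + ?Q)"
    using 1 2 by (simp add: distrib_left)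
  ultimately have "2 \<le> e\<^sup>2" by (metis mult_le_cancel_right_pos)
  then show ?thesis by (metis real_sqrt_abs real_sqrt_le_iff)
qed

text \<open>Every eigenvalue is large in absolute value, so it is enough that the median is some
  eigenvalue; the order of the spectrum need not be computed.\<close>

lemma HL_index_heawood: "HL_index heawood \<ge> sqrt 2"
proof -
  let ?M = "proots (char_poly (adjacency_mat heawood))"
  let ?i = "H_index heawood - 1"
  have size: "size ?M = 14"
    using size_eigenvalues[OF pair_graph_heawood] by (simp add: order_of_def pverts_heawood)
  have "?i < 14"
    using H_index_minus_1[OF pair_graph_heawood pverts_heawood_ne] by (simp add: order_of_def pverts_heawood)
  then have "?i < length (eigenvalue_list heawood)"
    using size by (metis eigenvalue_list_def length_rev mset_sorted_list_of_multiset size_mset)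
  then have "eigval heawood (H_index heawood) \<in> set (eigenvalue_list heawood)"
    unfolding eigval_def by (rule nth_mem)
  then have "eigval heawood (H_index heawood) \<in># ?M" by (simp add: eigenvalue_list_def)
  then show ?thesis using heawood_eigenvalues by (force simp: HL_index_def)
qed

theorem theorem2:
  shows "(\<forall>G :: 'a pair_pre_digraph. pair_graph G \<and> pverts G \<noteq> {} \<and> subcubic G \<longrightarrow>
            eigval G (H_index G) \<in> {- sqrt 2..sqrt 2} \<and>
            eigval G (L_index G) \<in> {- sqrt 2..sqrt 2})
         \<and> HL_sup 3 = sqrt 2"
proof (intro conjI allI impI)
  fix G :: "'a pair_pre_digraph"
  assume "pair_graph G \<and> pverts G \<noteq> {} \<and> subcubic G"
  then show "eigval G (H_index G) \<in> {- sqrt 2..sqrt 2}" "eigval G (L_index G) \<in> {- sqrt 2..sqrt 2}"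
    using median_eigenvalues_bounds by blast+
next
  have le: "HL_index G \<le> sqrt 2" if "pair_graph G" "pverts G \<noteq> {}" "real (max_degree G) \<le> 3"
    for G :: "nat pair_pre_digraph"
    using median_eigenvalues_bounds[OF that(1,2)] that(3) by (auto simp: HL_index_def subcubic_def abs_le_iff)
  have "HL_index heawood = sqrt 2"
    using le[OF pair_graph_heawood pverts_heawood_ne] HL_index_heawood max_degree_heawood by simp
  then have "sqrt 2 \<in> {HL_index G | G :: nat pair_pre_digraph.
      pair_graph G \<and> pverts G \<noteq> {} \<and> real (max_degree G) \<le> 3}"
    using pair_graph_heawood pverts_heawood_ne max_degree_heawood
    by (auto intro!: exI[of _ heawood])
  \<comment> \<open>The Heawood graph attains the upper bound, so the supremum is a maximum.\<close>
  then show "HL_sup 3 = sqrt 2"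
    unfolding HL_sup_def by (rule cSup_eq_maximum) (use le in auto)
qed

end
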